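(* Fix $\gamma>-1$. Let $\Phi(t)=\int_0^t\phi(s)\,ds$ be a Young function with complementary function $\Psi$. Let $M$ denote the Hardy–Littlewood maximal operator on $\mathbb{R}$, $$(Mf)(x)=\sup_{\substack{x\in I\\ I\text{ an interval}}}\frac1{|I|}\int_I|f(y)|\,dy,\qquad x\in\mathbb{R}.$$ Then the following assertions are equivalent: (G) there is $L>0$, independent of $f\in M(\mathbb{R})$, such that $\rho^{(1)}_{\Phi,|x|^{\gamma}}(Mf)\le L\,\rho^{(1)}_{\Phi,|x|^{\gamma}}(f)$ for all $f\in M(\mathbb{R})$; (I) $M:L_{\Phi,|x|^{\gamma}}(\mathbb{R})\to L_{\Phi,|x|^{\gamma}}(\mathbb{R})$; (M) there is $K>0$, independent of $f\in M(\mathbb{R})$, such that $$\int_{\mathbb{R}}\Phi\big((Mf)(x)\big)|x|^{\gamma}\,dx\le\int_{\mathbb{R}}\Phi\big(K|f(y)|\big)|y|^{\gamma}\,dy\qquad\text{for all } f\in M(\mathbb{R});$$ (BK) there is $C\ge1$, independent of $t\in\mathbb{R}_+$, such that $$\Psi(2t)\le C\,\Psi(t),\qquad t\in\mathbb{R}_+,$$ and either $-1<\gamma<0$, or $\gamma\ge0$ and $$\frac1t\int_0^t\phi^{-1}(s^{-\gamma})\,ds\le C\,\phi^{-1}(C\,t^{-\gamma}),\qquad t\in\mathbb{R}_+.$$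
   Context: $\mathbb{R}_+=(0,\infty)$; $M(\mathbb{R})$ is the class of Lebesgue-measurable functions on $\mathbb{R}$ (not to be confused with the operator $M$). A Young function is a function $\Phi(t)=\int_0^t\phi(s)\,ds$, $t\in\mathbb{R}_+$ (with $\Phi(0)=0$), where $\phi$ is nonnegative and nondecreasing on $\mathbb{R}_+$ with $\phi(0^+)=0$ and $\lim_{s\to\infty}\phi(s)=\infty$. Its complementary function is $\Psi(t)=\int_0^t\phi^{-1}(s)\,ds$, where $\phi^{-1}$ is the inverse of $\phi$ (the generalized inverse $\phi^{-1}(s)=\sup\{r>0:\phi(r)\le s\}$ if $\phi$ is not a bijection). The Orlicz class is $$L_{\Phi,|x|^{\gamma}}(\mathbb{R})=\Big\{f\in M(\mathbb{R}):\int_{\mathbb{R}}\Phi(k|f(x)|)|x|^{\gamma}dx<\infty\text{ for some }k\in\mathbb{R}_+\Big\},$$ and $$\rho^{(1)}_{\Phi,|x|^{\gamma}}(f)=\inf\Big\{\lambda>0:\int_{\mathbb{R}}\Phi\Big(\frac{|f(x)|}{\lambda}\Big)|x|^{\gamma}\,dx\le1\Big\}.$$ *)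

theory Defs
  imports "HOL-Analysis.Analysis"
begin

text \<open>
  Integrals that may diverge are taken as nonnegative integrals with values in
  \<^typ>\<open>ennreal\<close>; the Bochner integral would silently return 0 on divergence.
  Since \<open>M f\<close> may take the value \<open>\<infinity>\<close>, measurable functions are extended-real-valued,
  and Young functions are defined on \<open>[0, \<infinity>]\<close>.
\<close>

text \<open>Only the restriction of \<open>\<phi>\<close> to \<open>(0, \<infinity>)\<close> matters, here and below.\<close>

definition young_density :: "(real \<Rightarrow> real) \<Rightarrow> bool" where
  "young_density \<phi> \<longleftrightarrow>
     (\<forall>s>0. 0 \<le> \<phi> s) \<and> mono_on {0<..} \<phi> \<and>
     (\<phi> \<longlongrightarrow> 0) (at_right 0) \<and> filterlim \<phi> at_top at_top"

text \<open>
  \<open>\<Phi>(t) = \<integral>\<^sub>0\<^sup>t \<phi>(s) ds\<close> for \<open>t \<in> [0, \<infinity>]\<close>. A Young density is bounded on each bounded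
  interval and tends to \<open>\<infinity>\<close>, so \<open>\<Phi>(t)\<close> is finite for finite \<open>t\<close>, and \<open>\<Phi>(\<infinity>) = \<infinity>\<close>.
\<close>

definition young_function :: "(real \<Rightarrow> real) \<Rightarrow> ennreal \<Rightarrow> ennreal" where
  "young_function \<phi> t = (\<integral>\<^sup>+ s\<in>{s. 0 < s \<and> ennreal s < t}. ennreal (\<phi> s) \<partial>lborel)"

text \<open>
  For a Young density and \<open>s > 0\<close> the set below is nonempty and bounded above, so the
  supremum is a genuine one.
\<close>

definition gen_inverse :: "(real \<Rightarrow> real) \<Rightarrow> real \<Rightarrow> real" where
  "gen_inverse \<phi> s = Sup {r. 0 < r \<and> \<phi> r \<le> s}"

definition complementary_function :: "(real \<Rightarrow> real) \<Rightarrow> ennreal \<Rightarrow> ennreal" where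
  "complementary_function \<phi> = young_function (gen_inverse \<phi>)"

text \<open>The intervals are bounded and nondegenerate, and may be open, closed or half-open.\<close>

definition hardy_littlewood :: "(real \<Rightarrow> ereal) \<Rightarrow> real \<Rightarrow> ereal" where
  "hardy_littlewood f x = enn2ereal
     (SUP I\<in>{I. is_interval I \<and> bounded I \<and> 0 < emeasure lebesgue I \<and> x \<in> I}.
        (\<integral>\<^sup>+ y\<in>I. e2ennreal \<bar>f y\<bar> \<partial>lebesgue) / emeasure lebesgue I)"

text \<open>
  \<open>\<integral> \<Phi>(g(x)) |x|\<^sup>\<gamma> dx\<close> for nonnegative \<open>g\<close>. The convention \<open>0 powr \<gamma> = 0\<close> only concerns
  the null set \<open>{0}\<close>.
\<close>

definition orlicz_modular ::
    "(ennreal \<Rightarrow> ennreal) \<Rightarrow> real \<Rightarrow> (real \<Rightarrow> ereal) \<Rightarrow> ennreal" where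
  "orlicz_modular \<Phi> \<gamma> g =
     (\<integral>\<^sup>+ x. \<Phi> (e2ennreal (g x)) * ennreal (\<bar>x\<bar> powr \<gamma>) \<partial>lebesgue)"

definition orlicz_class :: "(ennreal \<Rightarrow> ennreal) \<Rightarrow> real \<Rightarrow> (real \<Rightarrow> ereal) set" where
  "orlicz_class \<Phi> \<gamma> =
     {f \<in> borel_measurable lebesgue.
        \<exists>k>0. orlicz_modular \<Phi> \<gamma> (\<lambda>x. ereal k * \<bar>f x\<bar>) < \<infinity>}"

text \<open>The infimum of the empty set is \<open>\<infinity>\<close>.\<close>

definition luxemburg_norm ::
    "(ennreal \<Rightarrow> ennreal) \<Rightarrow> real \<Rightarrow> (real \<Rightarrow> ereal) \<Rightarrow> ennreal" where
  "luxemburg_norm \<Phi> \<gamma> f =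
     Inf {ennreal l | l. 0 < l \<and> orlicz_modular \<Phi> \<gamma> (\<lambda>x. \<bar>f x\<bar> / ereal l) \<le> 1}"

end

theory Submission
  imports Defs
begin

text \<open>
The weight \<open>|x|\<^sup>\<gamma>\<close> is homogeneous, so dilating a function multiplies its modular
\<open>\<integral> \<Phi>(|f|) |x|\<^sup>\<gamma> dx\<close> by a constant. This is what makes the norm inequality as strong as the
modular one: a dilation brings any finite modular below 1, where the norm inequality is a
statement about the modular (\<open>modular_bound_of_norm_bound\<close>). The modular inequality gives the
inclusion of classes by homogeneity of the maximal operator, and the inclusion gives the norm
inequality by a gliding hump: the supremum of scaled counterexamples, of which the \<open>n\<close>-th
violates the bound with constant \<open>4\<^sup>n\<close>, lies in the class, but its maximal function does not
(\<open>norm_bound_of_preserves_class\<close>). So the first three assertions are equivalent, and it remains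
to compare the modular inequality with the growth conditions.

Everything on the side of the growth conditions is expressed by one number: \<open>q\<close> is a growth
exponent of \<open>\<phi>\<close> if \<open>\<phi>(ct) \<ge> k c\<^sup>q \<phi>(t)\<close> for some \<open>k > 0\<close> and all \<open>c \<ge> 1\<close>, \<open>t > 0\<close>. The doubling
condition for \<open>\<Psi>\<close> says that some \<open>q > 0\<close> is a growth exponent
(\<open>doubling_of_complementary_doubling\<close>, \<open>growth_exponent_pos_of_doubling\<close>). For \<open>\<gamma> > 0\<close> the
average condition gives a growth exponent \<open>q > \<gamma>\<close>; this is a self-improvement, as the condition
itself looks like the limiting case (\<open>growth_exponent_of_average_condition\<close>).

That the modular inequality implies the growth conditions is seen by testing it: a short
plateau near \<open>x = 1\<close> has a maximal function decaying like \<open>1/(x - 1)\<close>, whose logarithmically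
divergent integral forces doubling (\<open>doubling_of_modular_bound\<close>), and the function
\<open>\<phi>\<^sup>-\<^sup>1(x\<^sup>-\<^sup>\<gamma>)\<close> on \<open>(0, t)\<close>, extremal for Young's inequality, gives the average condition
(\<open>average_condition_of_modular_bound\<close>).

Conversely, let \<open>q > max(\<gamma>, 0)\<close> be a growth exponent and choose \<open>p\<close> with
\<open>max(\<gamma>, 0) < p - 1 < q\<close>. Because \<open>p - 1 > \<gamma>\<close>, the maximal operator is of weak type \<open>(p, p)\<close>
with respect to \<open>|x|\<^sup>\<gamma> dx\<close>, in a form that only sees the large values of the function
(\<open>maximal_weak_type\<close>). Because \<open>p - 1 < q\<close>, integrating the weak-type estimate against
\<open>\<phi>(s) ds\<close>, as in the proof of the Marcinkiewicz interpolation theorem, returns the modular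
inequality (\<open>modular_bound_real\<close>).
\<close>

section \<open>Young functions with a given density\<close>

lemma mono_on_positive_measurable:
  fixes f :: "real \<Rightarrow> real"
  assumes "mono_on {0<..} f"
  shows "(\<lambda>s. f s * indicator {0<..} s) \<in> borel_measurable borel"
proof (rule borel_measurable_piecewise_mono[of "{{..0}, {0<..}}"])
  show "mono_on c (\<lambda>s. f s * indicator {0<..} s)" if "c \<in> {{..0}, {0<..}}" for c :: "real set"
    using that assms by (auto simp: mono_on_def indicator_def)
qed auto

lemma young_function_indicator:
  "young_function f t =
    (\<integral>\<^sup>+ s. ennreal (f s * indicator {0<..} s) * indicator {s. ennreal s < t} s \<partial>lborel)"
  unfolding young_function_def
  by (intro nn_integral_cong) (auto simp: indicator_def)

lemma young_function_mono: "s \<le> t \<Longrightarrow> young_function f s \<le> young_function f t"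
  unfolding young_function_def
  by (intro nn_integral_mono) (auto simp: indicator_def)

lemma young_function_0 [simp]: "young_function f 0 = 0"
  unfolding young_function_def by simp

lemma mono_ennreal_measurable:
  fixes F :: "ennreal \<Rightarrow> ennreal"
  assumes "mono F"
  shows "F \<in> borel_measurable borel"
proof (rule borel_measurableI_greater)
  fix y
  let ?S = "{x. y < F x}"
  have up: "b \<in> ?S" if "a \<in> ?S" "a \<le> b" for a b
    using that monoD[OF assms that(2)] by auto
  have "?S = {Inf ?S..} \<or> ?S = {Inf ?S<..}"
  proof (cases "Inf ?S \<in> ?S")
    case True
    then have "?S = {Inf ?S..}" using up[OF True] by (intro set_eqI) (auto intro: Inf_lower)
    then show ?thesis by blast
  next
    case False
    have "x \<in> ?S \<longleftrightarrow> x \<in> {Inf ?S<..}" for x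
    proof
      assume x: "x \<in> ?S"
      then have "Inf ?S \<le> x" by (rule Inf_lower)
      moreover have "x \<noteq> Inf ?S" using x False by metis
      ultimately show "x \<in> {Inf ?S<..}" by simp
    next
      assume "x \<in> {Inf ?S<..}"
      then obtain a where "a \<in> ?S" "a < x" unfolding greaterThan_iff Inf_less_iff by blast
      then show "x \<in> ?S" using up[of a x] by (simp only: less_imp_le)
    qed
    then show ?thesis by blast
  qed
  then have "?S \<in> sets borel" by (metis atLeast_borel greaterThan_borel)
  then show "{x \<in> space borel. y < F x} \<in> sets borel" by simp
qed

lemma young_function_measurable [measurable]: "young_function f \<in> borel_measurable borel"
  by (rule mono_ennreal_measurable) (simp add: mono_def young_function_mono)

lemma ennreal_less_mult_iff: "0 < c \<Longrightarrow> ennreal (c * s) < ennreal c * t \<longleftrightarrow> ennreal s < t"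
proof (cases t)
  case (real r)
  assume c: "0 < c"
  have *: "ennreal (c * s) < ennreal (c * r) \<longleftrightarrow> ennreal s < ennreal r"
  proof (cases "0 \<le> s")
    case True
    then show ?thesis using c real by (simp add: ennreal_less_iff)
  next
    case False
    then have "c * s < 0" using c by (simp add: mult_pos_neg)
    then show ?thesis using False c real(1)
      by (simp add: ennreal_neg zero_less_mult_iff)
  qed
  show ?thesis using c real * by (simp add: ennreal_mult')
qed (auto simp: ennreal_mult_top)

lemma young_function_scale:
  assumes mono: "mono_on {0<..} f" and c: "0 < c"
  shows "young_function f (ennreal c * t) =
    ennreal c * young_function (\<lambda>s. f (c * s)) t"
proof -
  note [measurable] = mono_on_positive_measurable[OF mono]
  have "young_function f (ennreal c * t) = ennreal \<bar>c\<bar> *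
    (\<integral>\<^sup>+ s. ennreal (f (0 + c * s) * indicator {0<..} (0 + c * s))
        * indicator {s. ennreal s < ennreal c * t} (0 + c * s) \<partial>lborel)"
    unfolding young_function_indicator
    by (rule nn_integral_real_affine) (use c in auto)
  also have "\<dots> = ennreal c * young_function (\<lambda>s. f (c * s)) t"
    unfolding young_function_indicator using c
    by (auto simp: indicator_def zero_less_mult_iff ennreal_less_mult_iff
        intro!: arg_cong2[where f="(*)"] nn_integral_cong)
  finally show ?thesis .
qed

text \<open>
Convexity of the Young function in the only form used below: the density at \<open>cs\<close> dominates the
density at \<open>s\<close>.
\<close>

lemma young_function_le_scale:
  assumes "mono_on {0<..} f" "1 \<le> c"
  shows "ennreal c * young_function f t \<le> young_function f (ennreal c * t)"
proof -
  have "young_function f t \<le> young_function (\<lambda>s. f (c * s)) t"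
    unfolding young_function_def
  proof (intro nn_integral_mono)
    fix s :: real
    show "ennreal (f s) * indicator {s. 0 < s \<and> ennreal s < t} s
      \<le> ennreal (f (c * s)) * indicator {s. 0 < s \<and> ennreal s < t} s"
    proof (cases "0 < s")
      case True
      then have "s \<le> c * s" using assms(2) by simp
      then have "f s \<le> f (c * s)" using True assms(1) by (auto simp: mono_on_def)
      then show ?thesis by (intro mult_right_mono ennreal_leI) auto
    qed auto
  qed
  then show ?thesis
    using assms by (subst young_function_scale) (auto intro!: mult_left_mono)
qed

lemma young_function_le:
  assumes mono: "mono_on {0<..} f" and t: "0 < t"
  shows "young_function f (ennreal t) \<le> ennreal (t * f t)"
proof -
  have "young_function f (ennreal t) \<le> (\<integral>\<^sup>+ s. ennreal (f t) * indicator {0<..<t} s \<partial>lborel)"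
    unfolding young_function_def using t mono
    by (intro nn_integral_mono)
        (auto simp: indicator_def ennreal_less_iff mono_on_def intro!: ennreal_leI)
  also have "\<dots> = ennreal (t * f t)"
    using t by (simp add: nn_integral_cmult_indicator ennreal_mult' mult.commute)
  finally show ?thesis .
qed

lemma young_function_ge:
  assumes mono: "mono_on {0<..} f" and t: "0 < t"
  shows "ennreal (t * f t) \<le> young_function f (ennreal (2 * t))"
proof -
  have "ennreal (t * f t) = (\<integral>\<^sup>+ s. ennreal (f t) * indicator {t<..<2 * t} s \<partial>lborel)"
    using t by (simp add: nn_integral_cmult_indicator ennreal_mult' mult.commute)
  also have "\<dots> \<le> young_function f (ennreal (2 * t))"
    unfolding young_function_def using t mono
    by (intro nn_integral_mono)
        (auto simp: indicator_def ennreal_less_iff mono_on_def intro!: ennreal_leI)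
  finally show ?thesis .
qed

text \<open>
The set of \<open>s\<close> below a supremum is the union of the sets below its members, so countable
subadditivity does the work of Jensen's inequality when countably many functions are combined.
\<close>

lemma young_function_SUP_le:
  assumes "mono_on {0<..} f"
  shows "young_function f (SUP n. t n) \<le> (\<Sum>n. young_function f (t n))"
proof -
  note [measurable] = mono_on_positive_measurable[OF assms]
  have "young_function f (SUP n. t n) \<le>
      (\<integral>\<^sup>+ s. (\<Sum>n. ennreal (f s * indicator {0<..} s) * indicator {s. ennreal s < t n} s) \<partial>lborel)"
    unfolding young_function_indicator
  proof (intro nn_integral_mono)
    fix s
    show "ennreal (f s * indicator {0<..} s) * indicator {s. ennreal s < (SUP n. t n)} s
      \<le> (\<Sum>n. ennreal (f s * indicator {0<..} s) * indicator {s. ennreal s < t n} s)"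
    proof (cases "ennreal s < (SUP n. t n)")
      case True
      then obtain n where "ennreal s < t n" by (auto simp: less_SUP_iff)
      then have "ennreal (f s * indicator {0<..} s) * indicator {s. ennreal s < (SUP n. t n)} s
         = (\<Sum>k\<in>{n}. ennreal (f s * indicator {0<..} s) * indicator {s. ennreal s < t k} s)"
        using True by simp
      also have "\<dots> \<le> (\<Sum>n. ennreal (f s * indicator {0<..} s) * indicator {s. ennreal s < t n} s)"
        by (rule sum_le_suminf) auto
      finally show ?thesis .
    qed auto
  qed
  also have "\<dots> = (\<Sum>n. young_function f (t n))"
    unfolding young_function_indicator by (rule nn_integral_suminf) auto
  finally show ?thesis .
qed

section \<open>The generalized inverse of a density\<close>

lemma young_densityD:
  assumes "young_density \<phi>"
  shows "\<And>s. 0 < s \<Longrightarrow> 0 \<le> \<phi> s" "\<And>s t. 0 < s \<Longrightarrow> s \<le> t \<Longrightarrow> \<phi> s \<le> \<phi> t"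
    "mono_on {0<..} \<phi>"
  using assms by (auto simp: young_density_def mono_on_def)

lemma young_density_small:
  assumes "young_density \<phi>" "0 < s"
  obtains r where "0 < r" "\<phi> r \<le> s"
proof -
  have "eventually (\<lambda>r. \<phi> r < s) (at_right 0)"
    using assms by (auto simp: young_density_def intro: order_tendstoD)
  then obtain b where "b > 0" "\<forall>y>0. y < b \<longrightarrow> \<phi> y < s"
    by (auto simp: eventually_at_right_field)
  then show thesis by (intro that[of "b/2"]) (auto intro: less_imp_le)
qed

lemma young_density_large:
  assumes "young_density \<phi>"
  obtains r where "0 < r" "s < \<phi> r"
proof -
  have "eventually (\<lambda>r. s < \<phi> r \<and> 0 < r) at_top"
    using assms by (auto simp: young_density_def filterlim_at_top_dense
        intro: eventually_conj eventually_gt_at_top)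
  then show thesis using that by (auto simp: eventually_at_top_linorder)
qed

lemma gen_inverse_bdd:
  assumes "young_density \<phi>"
  shows "bdd_above {r. 0 < r \<and> \<phi> r \<le> s}"
proof -
  obtain R where R: "0 < R" "s < \<phi> R" using young_density_large[OF assms] .
  have "r \<le> R" if "0 < r" "\<phi> r \<le> s" for r
    using young_densityD(2)[OF assms, of R r] R that by linarith
  then show ?thesis by (auto simp: bdd_above_def)
qed

lemma gen_inverse_upper:
  assumes "young_density \<phi>" "0 < r" "\<phi> r \<le> s"
  shows "r \<le> gen_inverse \<phi> s"
  unfolding gen_inverse_def using assms(2,3) by (intro cSup_upper gen_inverse_bdd[OF assms(1)]) auto

lemma gen_inverse_least:
  assumes "young_density \<phi>" "0 < s" "\<And>r. 0 < r \<Longrightarrow> \<phi> r \<le> s \<Longrightarrow> r \<le> B"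
  shows "gen_inverse \<phi> s \<le> B"
  unfolding gen_inverse_def
proof (rule cSup_least)
  obtain r where "0 < r" "\<phi> r \<le> s" using young_density_small[OF assms(1,2)] .
  then show "{r. 0 < r \<and> \<phi> r \<le> s} \<noteq> {}" by blast
qed (use assms(3) in blast)

lemma gen_inverse_pos:
  assumes "young_density \<phi>" "0 < s" shows "0 < gen_inverse \<phi> s"
proof -
  obtain r where "0 < r" "\<phi> r \<le> s" using young_density_small[OF assms] .
  with gen_inverse_upper[OF assms(1) this] show ?thesis by linarith
qed

lemma density_below_gen_inverse:
  assumes "young_density \<phi>" "0 < s" "0 < r" "r < gen_inverse \<phi> s"
  shows "\<phi> r \<le> s"
proof (rule ccontr)
  assume "\<not> \<phi> r \<le> s"
  then have "x \<le> r" if "0 < x" "\<phi> x \<le> s" for x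
    using young_densityD(2)[OF assms(1,3), of x] that by linarith
  then have "gen_inverse \<phi> s \<le> r" by (intro gen_inverse_least assms)
  then show False using assms by simp
qed

lemma gen_inverse_mono:
  assumes "young_density \<phi>" "0 < s" "s \<le> t"
  shows "gen_inverse \<phi> s \<le> gen_inverse \<phi> t"
  by (rule gen_inverse_least[OF assms(1,2)], rule gen_inverse_upper[OF assms(1)])
      (use assms(3) in auto)

lemma gen_inverse_mono_on:
  assumes "young_density \<phi>" shows "mono_on {0<..} (gen_inverse \<phi>)"
  using gen_inverse_mono[OF assms] by (auto simp: mono_on_def)

lemma gen_inverse_powr_measurable:
  assumes \<phi>: "young_density \<phi>"
  shows "(\<lambda>s. gen_inverse \<phi> (s powr a) * indicator {0<..} s) \<in> borel_measurable borel"
proof -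
  note [measurable] = mono_on_positive_measurable[OF gen_inverse_mono_on[OF \<phi>]]
  have "(\<lambda>s. (gen_inverse \<phi> (s powr a) * indicator {0<..} (s powr a)) * indicator {0<..} s)
      \<in> borel_measurable borel"
    by measurable
  also have "(\<lambda>s. (gen_inverse \<phi> (s powr a) * indicator {0<..} (s powr a)) * indicator {0<..} s) =
      (\<lambda>s. gen_inverse \<phi> (s powr a) * indicator {0<..} s)"
    by (auto simp: indicator_def)
  finally show ?thesis .
qed

text \<open>
Inequalities between values of \<open>\<phi>\<close> and values of its generalized inverse translate into each
other with the two scaling factors exchanged. In this direction jumps and flat pieces of \<open>\<phi>\<close>
cost the passage from \<open>b\<close> to a larger \<open>b'\<close>.
\<close>

lemma density_growth_of_gen_inverse:
  assumes \<phi>: "young_density \<phi>" and A: "0 < A" and b: "b < b'" "1 \<le> b'"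
    and step: "\<And>s. 0 < s \<Longrightarrow> gen_inverse \<phi> (A * s) \<le> b * gen_inverse \<phi> s"
    and t: "0 < t"
  shows "A * \<phi> t \<le> \<phi> (b' * t)"
proof (rule ccontr)
  define S where "S = \<phi> (b' * t)"
  assume "\<not> A * \<phi> t \<le> \<phi> (b' * t)"
  then have less: "S < A * \<phi> t" by (simp add: S_def)
  have tt: "t \<le> b' * t" using b t by simp
  then have "\<phi> t \<le> S" unfolding S_def by (intro young_densityD(2)[OF \<phi> t])
  moreover have "0 \<le> \<phi> t" using young_densityD(1)[OF \<phi> t] .
  ultimately have S: "0 < S"
    using less by (cases "\<phi> t = 0") auto
  have "gen_inverse \<phi> (S / A) \<le> t"
  proof (rule gen_inverse_least[OF \<phi>])
    fix r assume r: "0 < r" "\<phi> r \<le> S / A"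
    have "S / A < \<phi> t" using less A by (simp add: field_simps)
    then show "r \<le> t"
      using young_densityD(2)[OF \<phi> t, of r] r by linarith
  qed (use S A in simp)
  moreover have "0 < gen_inverse \<phi> (S / A)" using \<phi> S A by (intro gen_inverse_pos) auto
  moreover have "b' * t \<le> gen_inverse \<phi> S"
    using b t by (intro gen_inverse_upper \<phi>) (auto simp: S_def)
  moreover have "gen_inverse \<phi> S \<le> b * gen_inverse \<phi> (S / A)"
    using step[of "S / A"] S A by simp
  ultimately have "b' * t \<le> b * gen_inverse \<phi> (S / A)" "gen_inverse \<phi> (S / A) \<le> t"
    "0 < gen_inverse \<phi> (S / A)"
    by auto
  moreover have "b * gen_inverse \<phi> (S / A) < b' * gen_inverse \<phi> (S / A)"
    using b \<open>0 < gen_inverse \<phi> (S / A)\<close> by simp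
  moreover have "b' * gen_inverse \<phi> (S / A) \<le> b' * t"
    using b \<open>gen_inverse \<phi> (S / A) \<le> t\<close> by (intro mult_left_mono) auto
  ultimately show False by linarith
qed

lemma gen_inverse_growth_of_density:
  assumes \<phi>: "young_density \<phi>" and "0 < A" "0 < b"
    and step: "\<And>t. 0 < t \<Longrightarrow> A * \<phi> t \<le> \<phi> (b * t)"
    and s: "0 < s"
  shows "gen_inverse \<phi> (A * s) \<le> b * gen_inverse \<phi> s"
proof (rule gen_inverse_least[OF \<phi>])
  fix r assume r: "0 < r" "\<phi> r \<le> A * s"
  have "A * \<phi> (r / b) \<le> \<phi> (b * (r / b))" using r assms(3) by (intro step) simp
  also have "\<dots> \<le> A * s" using r assms(3) by simp
  finally have "\<phi> (r / b) \<le> s" using assms(2) by simp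
  then have "r / b \<le> gen_inverse \<phi> s" using assms(3) r(1) by (intro gen_inverse_upper[OF \<phi>]) auto
  then show "r \<le> b * gen_inverse \<phi> s" using \<open>0 < b\<close> by (simp add: field_simps)
qed (use assms(2) s in simp)

section \<open>Growth exponents\<close>

text \<open>
For a positive \<open>\<phi>\<close>, the supremum of the exponents \<open>q\<close> described here is the lower Matuszewska
index of \<open>\<phi>\<close>.
\<close>

definition growth_exponent :: "(real \<Rightarrow> real) \<Rightarrow> real \<Rightarrow> bool" where
  "growth_exponent \<phi> q \<longleftrightarrow> (\<exists>k>0. \<forall>c\<ge>1. \<forall>t>0. k * c powr q * \<phi> t \<le> \<phi> (c * t))"

text \<open>
Iterating one step settles the powers of \<open>b\<close>; rounding \<open>c\<close> down to a power of \<open>b\<close> costs the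
constant factor \<open>b\<^sup>-\<^sup>q\<close>.
\<close>

lemma growth_exponent_of_step:
  assumes \<phi>: "young_density \<phi>" and b: "1 < b" and q: "0 \<le> q"
    and step: "\<And>t. 0 < t \<Longrightarrow> b powr q * \<phi> t \<le> \<phi> (b * t)"
  shows "growth_exponent \<phi> q"
  unfolding growth_exponent_def
proof (intro exI[of _ "b powr (-q)"] conjI allI impI)
  show "0 < b powr (- q)" using b by simp
  fix c t :: real assume c: "1 \<le> c" and t: "0 < t"
  have iter: "b powr (q * real n) * \<phi> t \<le> \<phi> (b ^ n * t)" for n
  proof (induction n)
    case (Suc n)
    have "b powr (q * real (Suc n)) * \<phi> t = b powr q * (b powr (q * real n) * \<phi> t)"
      by (simp add: algebra_simps powr_add)
    also have "\<dots> \<le> b powr q * \<phi> (b ^ n * t)" using Suc by (intro mult_left_mono) auto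
    also have "\<dots> \<le> \<phi> (b ^ Suc n * t)" using step[of "b ^ n * t"] b t by (simp add: mult.assoc)
    finally show ?case .
  qed (use b in simp)
  \<comment> \<open>The largest power of \<open>b\<close> not exceeding \<open>c\<close>.\<close>
  define n where "n = nat \<lfloor>log b c\<rfloor>"
  have "0 \<le> log b c" using b c by simp
  then have n: "real n \<le> log b c" "log b c < real n + 1"
    unfolding n_def by linarith+
  have "b ^ n \<le> c"
    using n(1) b c by (metis le_log_iff less_le_trans powr_realpow zero_less_one less_trans)
  have "c powr q \<le> b powr (q * (real n + 1))"
  proof -
    have "c \<le> b powr (real n + 1)"
      using n(2) b c by (subst (asm) log_less_iff) auto
    then have "c powr q \<le> (b powr (real n + 1)) powr q"
      using c q by (intro powr_mono2) auto
    then show ?thesis by (simp add: powr_powr mult.commute)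
  qed
  then have "b powr (-q) * c powr q \<le> b powr (-q) * b powr (q * (real n + 1))"
    by (intro mult_left_mono) auto
  also have "\<dots> = b powr (q * real n)" by (simp add: powr_add[symmetric] algebra_simps)
  finally have "b powr (-q) * c powr q * \<phi> t \<le> b powr (q * real n) * \<phi> t"
    using young_densityD(1)[OF \<phi> t] by (intro mult_right_mono)
  also have "\<dots> \<le> \<phi> (b ^ n * t)" by (rule iter)
  also have "\<dots> \<le> \<phi> (c * t)"
    using \<open>b ^ n \<le> c\<close> b t by (intro young_densityD(2)[OF \<phi>]) auto
  finally show "b powr (-q) * c powr q * \<phi> t \<le> \<phi> (c * t)" .
qed

section \<open>The maximal function over open intervals\<close>

lemma divide_ennreal_le_iff:
  assumes "0 < d"
  shows "a / ennreal d \<le> c \<longleftrightarrow> a \<le> c * ennreal d"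
  by (cases a; cases c)
     (use assms in \<open>auto simp: divide_ennreal ennreal_mult[symmetric] field_simps
        ennreal_top_mult ennreal_top_divide top_unique\<close>)

lemma ennreal_cancel_left_divide:
  assumes "0 < c" "0 < d"
  shows "ennreal c * A / ennreal (c * d) = A / ennreal d"
  by (cases A)
     (use assms in \<open>auto simp: divide_ennreal ennreal_mult[symmetric] ennreal_mult_top ennreal_top_divide\<close>)

text \<open>
The maximal operator for Borel functions with values in \<open>[0, \<infinity>]\<close>. Open intervals give the same
supremum as arbitrary ones, and they make the superlevel sets visibly open.
\<close>

definition maximal :: "(real \<Rightarrow> ennreal) \<Rightarrow> real \<Rightarrow> ennreal" where
  "maximal u x = (SUP (a, b)\<in>{(a, b). a < x \<and> x < b}.
     (\<integral>\<^sup>+ y\<in>{a<..<b}. u y \<partial>lborel) / ennreal (b - a))"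

lemma maximal_upper:
  "a < x \<Longrightarrow> x < b \<Longrightarrow> (\<integral>\<^sup>+ y\<in>{a<..<b}. u y \<partial>lborel) / ennreal (b - a) \<le> maximal u x"
  unfolding maximal_def by (rule SUP_upper2[of "(a, b)"]) auto

lemma less_maximal_iff:
  "l < maximal u x \<longleftrightarrow>
    (\<exists>a b. a < x \<and> x < b \<and> l < (\<integral>\<^sup>+ y\<in>{a<..<b}. u y \<partial>lborel) / ennreal (b - a))"
  unfolding maximal_def less_SUP_iff by auto

lemma open_less_maximal: "open {x. l < maximal u x}"
proof -
  have "{x. l < maximal u x} =
    (\<Union>(a, b)\<in>{(a, b). l < (\<integral>\<^sup>+ y\<in>{a<..<b}. u y \<partial>lborel) / ennreal (b - a)}. {a<..<b})"
    unfolding less_maximal_iff by (simp add: set_eq_iff) blast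
  then show ?thesis by (simp add: open_UN split_def)
qed

lemma maximal_measurable [measurable]: "maximal u \<in> borel_measurable borel"
  by (rule borel_measurableI_greater) (simp add: open_less_maximal borel_open)

lemma maximal_mono: "(\<And>y. u y \<le> v y) \<Longrightarrow> maximal u x \<le> maximal v x"
  unfolding maximal_def
  by (intro SUP_subset_mono order_refl)
      (auto intro!: divide_right_mono_ennreal nn_integral_mono mult_right_mono)

lemma maximal_cmult:
  assumes [measurable]: "u \<in> borel_measurable borel"
  shows "maximal (\<lambda>y. c * u y) x = c * maximal u x"
proof -
  have "(\<integral>\<^sup>+ y\<in>{a<..<b}. c * u y \<partial>lborel) / ennreal (b - a) =
     c * ((\<integral>\<^sup>+ y\<in>{a<..<b}. u y \<partial>lborel) / ennreal (b - a))" for a b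
    by (simp add: nn_integral_cmult mult.assoc ennreal_times_divide)
  then show ?thesis
    unfolding maximal_def SUP_mult_left_ennreal by (simp add: split_def)
qed

lemma maximal_dilation:
  assumes [measurable]: "u \<in> borel_measurable borel" and c: "0 < c"
  shows "maximal u (c * x) \<le> maximal (\<lambda>y. u (c * y)) x"
  unfolding maximal_def[of u]
proof (intro SUP_least, clarify)
  fix a b assume ab: "a < c * x" "c * x < b"
  have "(\<integral>\<^sup>+ y\<in>{a<..<b}. u y \<partial>lborel) =
     ennreal \<bar>c\<bar> * (\<integral>\<^sup>+ y. u (0 + c * y) * indicator {a<..<b} (0 + c * y) \<partial>lborel)"
    by (rule nn_integral_real_affine) (use c in auto)
  also have "\<dots> = ennreal c * (\<integral>\<^sup>+ y\<in>{a / c<..<b / c}. u (c * y) \<partial>lborel)"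
    using c by (auto intro!: arg_cong2[where f="(*)"] nn_integral_cong
        simp: indicator_def field_simps)
  finally have "(\<integral>\<^sup>+ y\<in>{a<..<b}. u y \<partial>lborel) / ennreal (b - a) =
     ennreal c * (\<integral>\<^sup>+ y\<in>{a / c<..<b / c}. u (c * y) \<partial>lborel) / ennreal (c * (b / c - a / c))"
    using c by (simp add: right_diff_distrib)
  also have "\<dots> = (\<integral>\<^sup>+ y\<in>{a / c<..<b / c}. u (c * y) \<partial>lborel) / ennreal (b / c - a / c)"
    using c ab by (intro ennreal_cancel_left_divide) (auto simp: field_simps)
  also have "\<dots> \<le> maximal (\<lambda>y. u (c * y)) x"
    using ab c by (intro maximal_upper) (auto simp: field_simps)
  finally show "(\<integral>\<^sup>+ y\<in>{a<..<b}. u y \<partial>lborel) / ennreal (b - a) \<le> maximal (\<lambda>y. u (c * y)) x" .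
qed

text \<open>
An arbitrary bounded interval lies between an open and a closed one with the same endpoints, so
its measure is their distance.
\<close>

lemma interval_between:
  fixes I :: "real set"
  assumes "is_interval I" "bounded I" "x \<in> I"
  obtains a b where "a \<le> b" "{a<..<b} \<subseteq> I" "I \<subseteq> {a..b}"
proof
  have bdd: "bdd_above I" "bdd_below I"
    using assms(2) by (auto intro: bounded_imp_bdd_above bounded_imp_bdd_below)
  show "I \<subseteq> {Inf I..Sup I}" using bdd by (auto intro: cInf_lower cSup_upper)
  then show "Inf I \<le> Sup I" using assms(3) by fastforce
  show "{Inf I<..<Sup I} \<subseteq> I"
  proof
    fix y assume "y \<in> {Inf I<..<Sup I}"
    then have "Inf I < y" "y < Sup I" by auto
    then obtain c d where "c \<in> I" "c < y" "d \<in> I" "y < d"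
      using assms(3) bdd by (metis cInf_less_iff less_cSup_iff empty_iff)
    then show "y \<in> I" using assms(1) unfolding is_interval_1 by (meson less_imp_le)
  qed
qed

text \<open>
Fattening an interval to an open one changes its length, hence the average, arbitrarily little
and can only enlarge the integral.
\<close>

lemma hardy_littlewood_eq_maximal:
  assumes u [measurable]: "u \<in> borel_measurable borel"
    and ae: "AE y in lebesgue. e2ennreal \<bar>f y\<bar> = u y"
  shows "hardy_littlewood f x = enn2ereal (maximal u x)"
proof -
  let ?Is = "{I. is_interval I \<and> bounded I \<and> 0 < emeasure lebesgue I \<and> x \<in> I}"
  let ?avg = "\<lambda>I. (\<integral>\<^sup>+ y\<in>I. e2ennreal \<bar>f y\<bar> \<partial>lebesgue) / emeasure lebesgue I"
  have int: "(\<integral>\<^sup>+ y\<in>I. e2ennreal \<bar>f y\<bar> \<partial>lebesgue) = (\<integral>\<^sup>+ y\<in>I. u y \<partial>lborel)" for I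
  proof -
    have "(\<integral>\<^sup>+ y\<in>I. e2ennreal \<bar>f y\<bar> \<partial>lebesgue) = (\<integral>\<^sup>+ y\<in>I. u y \<partial>lebesgue)"
      by (rule nn_integral_cong_AE) (use ae in auto)
    then show ?thesis by (simp add: nn_integral_completion)
  qed
  have "(SUP I\<in>?Is. ?avg I) = maximal u x"
  proof (rule antisym)
    show "maximal u x \<le> (SUP I\<in>?Is. ?avg I)"
      unfolding maximal_def
    proof (intro SUP_least, clarify)
      fix a b assume ab: "a < x" "x < b"
      then have "(\<integral>\<^sup>+ y\<in>{a<..<b}. u y \<partial>lborel) / ennreal (b - a) = ?avg {a<..<b}"
        by (simp add: int)
      also have "\<dots> \<le> (SUP I\<in>?Is. ?avg I)"
        by (rule SUP_upper) (use ab in \<open>auto simp: is_interval_1\<close>)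
      finally show "(\<integral>\<^sup>+ y\<in>{a<..<b}. u y \<partial>lborel) / ennreal (b - a) \<le> (SUP I\<in>?Is. ?avg I)" .
    qed
    show "(SUP I\<in>?Is. ?avg I) \<le> maximal u x"
    proof (intro SUP_least, clarify)
      fix I assume I: "is_interval I" "bounded I" "0 < emeasure lebesgue I" "x \<in> I"
      obtain a b where ab: "a \<le> b" "{a<..<b} \<subseteq> I" "I \<subseteq> {a..b}"
        using interval_between[OF I(1,2,4)] .
      have [measurable]: "I \<in> sets borel" using I(1) using is_real_interval[OF I(1)] by auto
      have "emeasure lborel I = ennreal (b - a)"
      proof (rule antisym)
        show "ennreal (b - a) \<le> emeasure lborel I"
          using emeasure_mono[OF ab(2), of lborel] ab(1) by simp
        show "emeasure lborel I \<le> ennreal (b - a)"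
          using emeasure_mono[OF ab(3), of lborel] ab(1) by simp
      qed
      then have meas: "emeasure lebesgue I = ennreal (b - a)" by simp
      then have less: "a < b" using I(3) by simp
      let ?A = "\<integral>\<^sup>+ y\<in>I. u y \<partial>lborel"
      have avg: "?A \<le> maximal u x * ennreal (b - a + 2 * d)" if d: "0 < d" for d
      proof -
        have "?A \<le> (\<integral>\<^sup>+ y\<in>{a - d<..<b + d}. u y \<partial>lborel)"
          using ab d by (intro nn_integral_mono) (auto simp: indicator_def)
        also have "\<dots> / ennreal (b + d - (a - d)) \<le> maximal u x"
          by (rule maximal_upper) (use ab I(4) d in auto)
        then have "(\<integral>\<^sup>+ y\<in>{a - d<..<b + d}. u y \<partial>lborel) \<le> maximal u x * ennreal (b + d - (a - d))"
          using less d by (subst (asm) divide_ennreal_le_iff) auto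
        finally show ?thesis by (simp add: algebra_simps)
      qed
      have "?A \<le> maximal u x * ennreal (b - a)"
      proof (cases "maximal u x")
        case (real r)
        show ?thesis
        proof (rule ennreal_le_epsilon)
          fix e :: real assume e: "0 < e"
          \<comment> \<open>Adding 1 to \<open>r\<close> covers the case that the maximal function vanishes.\<close>
          define d where "d = e / (2 * (r + 1))"
          have d: "0 < d" "r * (2 * d) \<le> e"
            using e real by (auto simp: d_def field_simps)
          have "?A \<le> ennreal (r * (b - a + 2 * d))"
            using avg[OF d(1)] real less d by (simp add: ennreal_mult'')
          also have "\<dots> \<le> ennreal (r * (b - a) + e)"
            using d by (intro ennreal_leI) (simp add: algebra_simps)
          also have "\<dots> = maximal u x * ennreal (b - a) + ennreal e"
            using real less e by (simp add: ennreal_mult'' ennreal_plus)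
          finally show "?A \<le> maximal u x * ennreal (b - a) + ennreal e" .
        qed
      next
        case top
        then show ?thesis using less by (simp add: ennreal_top_mult)
      qed
      then show "?avg I \<le> maximal u x"
        unfolding int meas using less by (subst divide_ennreal_le_iff) auto
    qed
  qed
  then show ?thesis unfolding hardy_littlewood_def by simp
qed

section \<open>Modulars and norms of Borel representatives\<close>

definition weighted_modular :: "(real \<Rightarrow> real) \<Rightarrow> real \<Rightarrow> (real \<Rightarrow> ennreal) \<Rightarrow> ennreal" where
  "weighted_modular \<phi> \<gamma> u = (\<integral>\<^sup>+ x. young_function \<phi> (u x) * ennreal (\<bar>x\<bar> powr \<gamma>) \<partial>lborel)"

definition weighted_norm :: "(real \<Rightarrow> real) \<Rightarrow> real \<Rightarrow> (real \<Rightarrow> ennreal) \<Rightarrow> ennreal" where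
  "weighted_norm \<phi> \<gamma> u =
     Inf {ennreal l | l. 0 < l \<and> weighted_modular \<phi> \<gamma> (\<lambda>x. ennreal (1 / l) * u x) \<le> 1}"

lemma orlicz_modular_eq:
  assumes "AE x in lebesgue. e2ennreal (g x) = u x"
  shows "orlicz_modular (young_function \<phi>) \<gamma> g = weighted_modular \<phi> \<gamma> u"
proof -
  have "orlicz_modular (young_function \<phi>) \<gamma> g =
      (\<integral>\<^sup>+ x. young_function \<phi> (u x) * ennreal (\<bar>x\<bar> powr \<gamma>) \<partial>lebesgue)"
    unfolding orlicz_modular_def by (rule nn_integral_cong_AE) (use assms in auto)
  then show ?thesis by (simp add: weighted_modular_def nn_integral_completion)
qed

text \<open>
A Lebesgue measurable function is replaced by a Borel function of its absolute value, equal to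
it almost everywhere. Averages and modulars do not notice the change, and for Borel functions
dilations and Fubini's theorem are available without completing the measure.
\<close>

definition represents :: "(real \<Rightarrow> ereal) \<Rightarrow> (real \<Rightarrow> ennreal) \<Rightarrow> bool" where
  "represents f u \<longleftrightarrow> f \<in> borel_measurable lebesgue \<and> u \<in> borel_measurable borel \<and>
     (AE x in lebesgue. e2ennreal \<bar>f x\<bar> = u x)"

lemma represents_exists:
  assumes [measurable]: "f \<in> borel_measurable lebesgue"
  shows "\<exists>u. represents f u"
proof -
  have "(\<lambda>x. e2ennreal \<bar>f x\<bar>) \<in> borel_measurable lebesgue" by measurable
  from completion_ex_borel_measurable[OF this]
  obtain u where "u \<in> borel_measurable lborel" "AE x in lborel. e2ennreal \<bar>f x\<bar> = u x" by auto
  then show ?thesis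
    using assms by (auto simp: represents_def intro: AE_completion)
qed

lemma represents_enn2ereal:
  assumes [measurable]: "u \<in> borel_measurable borel"
  shows "represents (\<lambda>x. enn2ereal (u x)) u"
  unfolding represents_def by (auto intro!: measurable_completion)

lemma represents_hardy_littlewood:
  assumes "represents f u"
  shows "hardy_littlewood f = (\<lambda>x. enn2ereal (maximal u x))"
  using assms hardy_littlewood_eq_maximal by (auto simp: represents_def)

lemma e2ennreal_cmult: "0 \<le> k \<Longrightarrow> e2ennreal (ereal k * \<bar>y\<bar>) = ennreal k * e2ennreal \<bar>y\<bar>"
  by (cases y; cases "k = 0") (auto simp: ennreal_mult ennreal_mult_top e2ennreal_neg)

lemma orlicz_modular_represents:
  assumes "represents f u" "0 \<le> k"
  shows "orlicz_modular (young_function \<phi>) \<gamma> (\<lambda>x. ereal k * \<bar>f x\<bar>) =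
    weighted_modular \<phi> \<gamma> (\<lambda>x. ennreal k * u x)"
  using assms by (intro orlicz_modular_eq) (auto simp: represents_def e2ennreal_cmult)

lemma luxemburg_norm_represents:
  assumes "represents f u"
  shows "luxemburg_norm (young_function \<phi>) \<gamma> f = weighted_norm \<phi> \<gamma> u"
proof -
  have "(\<lambda>x. \<bar>f x\<bar> / ereal l) = (\<lambda>x. ereal (1 / l) * \<bar>f x\<bar>)" if "0 < l" for l
    using that by (auto simp: divide_ereal_def inverse_eq_divide mult.commute)
  then show ?thesis
    unfolding luxemburg_norm_def weighted_norm_def
    using orlicz_modular_represents[OF assms] by (intro arg_cong[where f=Inf]) auto
qed

lemma orlicz_class_represents:
  assumes "represents f u"
  shows "f \<in> orlicz_class (young_function \<phi>) \<gamma> \<longleftrightarrow>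
    (\<exists>k>0. weighted_modular \<phi> \<gamma> (\<lambda>x. ennreal k * u x) < \<infinity>)"
  using assms orlicz_modular_represents[OF assms, of _ \<phi> \<gamma>]
  unfolding orlicz_class_def by (auto simp: represents_def)

definition maximal_modular_bound :: "(real \<Rightarrow> real) \<Rightarrow> real \<Rightarrow> bool" where
  "maximal_modular_bound \<phi> \<gamma> \<longleftrightarrow> (\<exists>K>0. \<forall>u \<in> borel_measurable borel.
     weighted_modular \<phi> \<gamma> (maximal u) \<le> weighted_modular \<phi> \<gamma> (\<lambda>y. ennreal K * u y))"

definition maximal_norm_bound :: "(real \<Rightarrow> real) \<Rightarrow> real \<Rightarrow> bool" where
  "maximal_norm_bound \<phi> \<gamma> \<longleftrightarrow> (\<exists>L>0. \<forall>u \<in> borel_measurable borel.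
     weighted_norm \<phi> \<gamma> (maximal u) \<le> ennreal L * weighted_norm \<phi> \<gamma> u)"

definition maximal_preserves_class :: "(real \<Rightarrow> real) \<Rightarrow> real \<Rightarrow> bool" where
  "maximal_preserves_class \<phi> \<gamma> \<longleftrightarrow> (\<forall>u \<in> borel_measurable borel.
     (\<exists>k>0. weighted_modular \<phi> \<gamma> (\<lambda>x. ennreal k * u x) < \<infinity>) \<longrightarrow>
     (\<exists>k>0. weighted_modular \<phi> \<gamma> (\<lambda>x. ennreal k * maximal u x) < \<infinity>))"

text \<open>
Transfers statements between the two kinds of functions: every Lebesgue measurable function has
a Borel representative, and every nonnegative Borel function represents itself.
\<close>

lemma all_represented:
  assumes "\<And>f u. represents f u \<Longrightarrow> P f \<longleftrightarrow> Q u"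
  shows "(\<forall>f \<in> borel_measurable lebesgue. P f) \<longleftrightarrow> (\<forall>u \<in> borel_measurable borel. Q u)"
proof
  assume P: "\<forall>f \<in> borel_measurable lebesgue. P f"
  show "\<forall>u \<in> borel_measurable borel. Q u"
    using P assms represents_enn2ereal by (metis represents_def)
next
  assume Q: "\<forall>u \<in> borel_measurable borel. Q u"
  show "\<forall>f \<in> borel_measurable lebesgue. P f"
    using Q assms represents_exists by (metis represents_def)
qed

lemma hardy_littlewood_represents:
  assumes "represents f u"
  shows "represents (hardy_littlewood f) (maximal u)"
  unfolding represents_hardy_littlewood[OF assms] by (rule represents_enn2ereal) simp

lemma modular_bound_iff:
  "(\<exists>K>0. \<forall>f \<in> borel_measurable lebesgue.
      orlicz_modular (young_function \<phi>) \<gamma> (hardy_littlewood f)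
        \<le> orlicz_modular (young_function \<phi>) \<gamma> (\<lambda>y. ereal K * \<bar>f y\<bar>))
   \<longleftrightarrow> maximal_modular_bound \<phi> \<gamma>"
proof -
  have "orlicz_modular (young_function \<phi>) \<gamma> (hardy_littlewood f) = weighted_modular \<phi> \<gamma> (maximal u)"
    if "represents f u" for f u
    unfolding represents_hardy_littlewood[OF that] by (rule orlicz_modular_eq) simp
  then show ?thesis
    unfolding maximal_modular_bound_def
    by (intro ex_cong1 conj_cong refl all_represented) (simp add: orlicz_modular_represents)
qed

lemma norm_bound_iff:
  "(\<exists>L>0. \<forall>f \<in> borel_measurable lebesgue.
      luxemburg_norm (young_function \<phi>) \<gamma> (hardy_littlewood f)
        \<le> ennreal L * luxemburg_norm (young_function \<phi>) \<gamma> f)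
   \<longleftrightarrow> maximal_norm_bound \<phi> \<gamma>"
  unfolding maximal_norm_bound_def
  by (intro ex_cong1 conj_cong refl all_represented)
     (simp add: luxemburg_norm_represents luxemburg_norm_represents[OF hardy_littlewood_represents])

lemma preserves_class_iff:
  "hardy_littlewood \<in> orlicz_class (young_function \<phi>) \<gamma> \<rightarrow> orlicz_class (young_function \<phi>) \<gamma>
   \<longleftrightarrow> maximal_preserves_class \<phi> \<gamma>"
proof -
  let ?L = "orlicz_class (young_function \<phi>) \<gamma>"
  have "hardy_littlewood \<in> ?L \<rightarrow> ?L \<longleftrightarrow>
    (\<forall>f \<in> borel_measurable lebesgue. f \<in> ?L \<longrightarrow> hardy_littlewood f \<in> ?L)"
    unfolding Pi_iff by (auto simp: orlicz_class_def)
  also have "\<dots> \<longleftrightarrow> maximal_preserves_class \<phi> \<gamma>"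
    unfolding maximal_preserves_class_def
    by (intro all_represented)
       (simp add: orlicz_class_represents orlicz_class_represents[OF hardy_littlewood_represents])
  finally show ?thesis .
qed

section \<open>Class inclusion, norm inequality and modular inequality\<close>

lemma weighted_modular_mono:
  "(\<And>x. u x \<le> v x) \<Longrightarrow> weighted_modular \<phi> \<gamma> u \<le> weighted_modular \<phi> \<gamma> v"
  unfolding weighted_modular_def
  by (intro nn_integral_mono mult_right_mono young_function_mono) auto

text \<open>
Convexity again: a factor below 1 inside the Young function can be taken out of the modular.
\<close>

lemma weighted_modular_shrink:
  assumes mono: "mono_on {0<..} \<phi>" and [measurable]: "u \<in> borel_measurable borel"
    and c: "0 < c" "c \<le> 1"
  shows "weighted_modular \<phi> \<gamma> (\<lambda>x. ennreal c * u x) \<le> ennreal c * weighted_modular \<phi> \<gamma> u"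
proof -
  have "young_function \<phi> (ennreal c * t) \<le> ennreal c * young_function \<phi> t" for t
  proof -
    have "ennreal (1 / c) * young_function \<phi> (ennreal c * t)
        \<le> young_function \<phi> (ennreal (1 / c) * (ennreal c * t))"
      using c by (intro young_function_le_scale mono) auto
    also have "ennreal (1 / c) * (ennreal c * t) = t"
      using c by (simp add: mult.assoc[symmetric] ennreal_mult''[symmetric])
    finally have "ennreal c * (ennreal (1 / c) * young_function \<phi> (ennreal c * t))
        \<le> ennreal c * young_function \<phi> t"
      by (intro mult_left_mono) auto
    then show ?thesis using c by (simp add: mult.assoc[symmetric] ennreal_mult''[symmetric])
  qed
  then have "weighted_modular \<phi> \<gamma> (\<lambda>x. ennreal c * u x) \<le>
      (\<integral>\<^sup>+ x. ennreal c * (young_function \<phi> (u x) * ennreal (\<bar>x\<bar> powr \<gamma>)) \<partial>lborel)"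
    unfolding weighted_modular_def mult.assoc[symmetric]
    by (intro nn_integral_mono mult_right_mono) auto
  also have "\<dots> = ennreal c * weighted_modular \<phi> \<gamma> u"
    unfolding weighted_modular_def by (rule nn_integral_cmult) simp
  finally show ?thesis .
qed

lemma weighted_modular_dilation:
  assumes [measurable]: "u \<in> borel_measurable borel" and c: "0 < c"
  shows "weighted_modular \<phi> \<gamma> u = ennreal (c powr (1 + \<gamma>)) * weighted_modular \<phi> \<gamma> (\<lambda>x. u (c * x))"
proof -
  have "weighted_modular \<phi> \<gamma> u = ennreal \<bar>c\<bar> *
     (\<integral>\<^sup>+ x. young_function \<phi> (u (0 + c * x)) * ennreal (\<bar>0 + c * x\<bar> powr \<gamma>) \<partial>lborel)"
    unfolding weighted_modular_def by (rule nn_integral_real_affine) (use c in auto)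
  also have "\<dots> = ennreal c *
     (\<integral>\<^sup>+ x. ennreal (c powr \<gamma>) * (young_function \<phi> (u (c * x)) * ennreal (\<bar>x\<bar> powr \<gamma>)) \<partial>lborel)"
    using c by (simp add: abs_mult powr_mult ennreal_mult'' ac_simps)
  also have "\<dots> = ennreal c * (ennreal (c powr \<gamma>) * weighted_modular \<phi> \<gamma> (\<lambda>x. u (c * x)))"
    unfolding weighted_modular_def by (subst nn_integral_cmult) auto
  also have "\<dots> = ennreal (c powr (1 + \<gamma>)) * weighted_modular \<phi> \<gamma> (\<lambda>x. u (c * x))"
    using c by (simp add: mult.assoc[symmetric] ennreal_mult''[symmetric] powr_add)
  finally show ?thesis .
qed

lemma weighted_modular_SUP_le:
  assumes mono: "mono_on {0<..} \<phi>" and [measurable]: "\<And>n. u n \<in> borel_measurable borel"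
  shows "weighted_modular \<phi> \<gamma> (\<lambda>x. SUP n. u n x) \<le> (\<Sum>n. weighted_modular \<phi> \<gamma> (u n))"
proof -
  have "weighted_modular \<phi> \<gamma> (\<lambda>x. SUP n. u n x) \<le>
     (\<integral>\<^sup>+ x. (\<Sum>n. young_function \<phi> (u n x) * ennreal (\<bar>x\<bar> powr \<gamma>)) \<partial>lborel)"
    unfolding weighted_modular_def ennreal_suminf_multc
    by (intro nn_integral_mono mult_right_mono young_function_SUP_le mono) auto
  also have "\<dots> = (\<Sum>n. weighted_modular \<phi> \<gamma> (u n))"
    unfolding weighted_modular_def by (rule nn_integral_suminf) simp
  finally show ?thesis .
qed

lemma weighted_norm_le:
  "0 < l \<Longrightarrow> weighted_modular \<phi> \<gamma> (\<lambda>x. ennreal (1 / l) * u x) \<le> 1 \<Longrightarrow> weighted_norm \<phi> \<gamma> u \<le> ennreal l"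
  unfolding weighted_norm_def by (rule Inf_lower) auto

lemma weighted_modular_le_1_of_norm_less:
  assumes "weighted_norm \<phi> \<gamma> u < ennreal l" 
  shows "weighted_modular \<phi> \<gamma> (\<lambda>x. ennreal (1 / l) * u x) \<le> 1"
proof -
  obtain l' where l': "0 < l'" "ennreal l' < ennreal l"
      "weighted_modular \<phi> \<gamma> (\<lambda>x. ennreal (1 / l') * u x) \<le> 1"
    using assms unfolding weighted_norm_def Inf_less_iff by auto
  then have "l' < l" by (simp add: ennreal_less_iff)
  then have "weighted_modular \<phi> \<gamma> (\<lambda>x. ennreal (1 / l) * u x)
      \<le> weighted_modular \<phi> \<gamma> (\<lambda>x. ennreal (1 / l') * u x)"
    using l' by (intro weighted_modular_mono mult_right_mono ennreal_leI) (auto simp: field_simps)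
  then show ?thesis using l' by simp
qed

lemma preserves_class_of_modular_bound:
  assumes "maximal_modular_bound \<phi> \<gamma>"
  shows "maximal_preserves_class \<phi> \<gamma>"
  unfolding maximal_preserves_class_def
proof safe
  fix u :: "real \<Rightarrow> ennreal" and k :: real
  assume u [measurable]: "u \<in> borel_measurable borel" and k: "0 < k"
    and fin: "weighted_modular \<phi> \<gamma> (\<lambda>x. ennreal k * u x) < \<infinity>"
  obtain K where K: "0 < K" and bound: "\<And>u. u \<in> borel_measurable borel \<Longrightarrow>
     weighted_modular \<phi> \<gamma> (maximal u) \<le> weighted_modular \<phi> \<gamma> (\<lambda>y. ennreal K * u y)"
    using assms unfolding maximal_modular_bound_def by blast
  have "weighted_modular \<phi> \<gamma> (\<lambda>x. ennreal (k / K) * maximal u x)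
      = weighted_modular \<phi> \<gamma> (maximal (\<lambda>y. ennreal (k / K) * u y))"
    by (simp add: maximal_cmult[OF u, abs_def])
  also have "\<dots> \<le> weighted_modular \<phi> \<gamma> (\<lambda>y. ennreal K * (ennreal (k / K) * u y))"
    by (rule bound) simp
  also have "(\<lambda>y. ennreal K * (ennreal (k / K) * u y)) = (\<lambda>y. ennreal k * u y)"
    using k K by (simp add: mult.assoc[symmetric] ennreal_mult''[symmetric])
  finally show "\<exists>k>0. weighted_modular \<phi> \<gamma> (\<lambda>x. ennreal k * maximal u x) < \<infinity>"
    using fin k K by (intro exI[of _ "k / K"]) (auto intro: le_less_trans)
qed

text \<open>
By homogeneity it suffices to control the maximal operator on the unit ball of the modular.
Working with the modular avoids deciding whether the infimum in the norm is attained.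
\<close>

lemma norm_bound_of_unit_ball:
  assumes L: "0 < L"
    and unit: "\<And>v. v \<in> borel_measurable borel \<Longrightarrow> weighted_modular \<phi> \<gamma> v \<le> 1 \<Longrightarrow>
      weighted_modular \<phi> \<gamma> (\<lambda>x. ennreal (1 / L) * maximal v x) \<le> 1"
  shows "maximal_norm_bound \<phi> \<gamma>"
  unfolding maximal_norm_bound_def
proof (intro exI[of _ L] conjI ballI L)
  fix u :: "real \<Rightarrow> ennreal" assume u [measurable]: "u \<in> borel_measurable borel"
  have "weighted_norm \<phi> \<gamma> (maximal u) / ennreal L \<le> weighted_norm \<phi> \<gamma> u"
    unfolding weighted_norm_def[of \<phi> \<gamma> u]
  proof (intro Inf_greatest, clarify)
    fix l :: real assume l: "0 < l" "weighted_modular \<phi> \<gamma> (\<lambda>x. ennreal (1 / l) * u x) \<le> 1"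
    have "weighted_modular \<phi> \<gamma> (\<lambda>x. ennreal (1 / L) * maximal (\<lambda>x. ennreal (1 / l) * u x) x) \<le> 1"
      by (rule unit) (use l in auto)
    also have "(\<lambda>x. ennreal (1 / L) * maximal (\<lambda>x. ennreal (1 / l) * u x) x)
        = (\<lambda>x. ennreal (1 / (l * L)) * maximal u x)"
    proof
      fix x
      have "ennreal (1 / L) * (ennreal (1 / l) * maximal u x) = ennreal (1 / (l * L)) * maximal u x"
        using l L by (simp add: mult.assoc[symmetric] ennreal_mult''[symmetric] mult.commute[of l])
      then show "ennreal (1 / L) * maximal (\<lambda>x. ennreal (1 / l) * u x) x
          = ennreal (1 / (l * L)) * maximal u x"
        by (simp only: maximal_cmult[OF u])
    qed
    finally have "weighted_norm \<phi> \<gamma> (maximal u) \<le> ennreal (l * L)"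
      using l L by (intro weighted_norm_le) auto
    then show "weighted_norm \<phi> \<gamma> (maximal u) / ennreal L \<le> ennreal l"
      using l L by (simp add: divide_ennreal_le_iff ennreal_mult'')
  qed
  then show "weighted_norm \<phi> \<gamma> (maximal u) \<le> ennreal L * weighted_norm \<phi> \<gamma> u"
    using L by (simp add: divide_ennreal_le_iff mult.commute)
qed

text \<open>
If no constant works, there are functions \<open>v n\<close> of modular at most 1 whose maximal functions,
divided by \<open>4\<^sup>n\<close>, still have modular above 1. The function \<open>u = sup 2\<^sup>-\<^sup>n v n\<close> lies in the
class, but its maximal function is at least \<open>2\<^sup>-\<^sup>n\<close> times that of \<open>v n\<close>, and a factor \<open>2\<^sup>n\<close>
always remains for making the modular of a multiple of it too large.
\<close>

lemma norm_bound_of_preserves_class: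
  assumes mono: "mono_on {0<..} \<phi>" and I: "maximal_preserves_class \<phi> \<gamma>"
  shows "maximal_norm_bound \<phi> \<gamma>"
proof (rule ccontr)
  assume "\<not> maximal_norm_bound \<phi> \<gamma>"
  then have "\<forall>n. \<exists>v. v \<in> borel_measurable borel \<and> weighted_modular \<phi> \<gamma> v \<le> 1 \<and>
      \<not> weighted_modular \<phi> \<gamma> (\<lambda>x. ennreal (1 / 4 ^ n) * maximal v x) \<le> 1"
    using norm_bound_of_unit_ball[of "4 ^ n" \<phi> \<gamma> for n] by (auto simp: zero_less_power)
  then obtain v where v [measurable]: "\<And>n. v n \<in> borel_measurable borel"
    and v1: "\<And>n. weighted_modular \<phi> \<gamma> (v n) \<le> 1"
    and large: "\<And>n. \<not> weighted_modular \<phi> \<gamma> (\<lambda>x. ennreal (1 / 4 ^ n) * maximal (v n) x) \<le> 1"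
    by metis
  define u where "u = (\<lambda>x. SUP n. ennreal ((1 / 2) ^ n) * v n x)"
  have u [measurable]: "u \<in> borel_measurable borel" unfolding u_def by measurable
  have "weighted_modular \<phi> \<gamma> u \<le> (\<Sum>n. weighted_modular \<phi> \<gamma> (\<lambda>x. ennreal ((1 / 2) ^ n) * v n x))"
    unfolding u_def by (rule weighted_modular_SUP_le[OF mono]) simp
  also have "\<dots> \<le> (\<Sum>n. ennreal ((1 / 2) ^ n))"
  proof (rule suminf_le)
    fix n
    have "weighted_modular \<phi> \<gamma> (\<lambda>x. ennreal ((1 / 2) ^ n) * v n x)
        \<le> ennreal ((1 / 2) ^ n) * weighted_modular \<phi> \<gamma> (v n)"
      by (rule weighted_modular_shrink[OF mono]) (auto intro: power_le_one)
    also have "\<dots> \<le> ennreal ((1 / 2) ^ n) * 1" by (intro mult_left_mono v1) simp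
    finally show "weighted_modular \<phi> \<gamma> (\<lambda>x. ennreal ((1 / 2) ^ n) * v n x)
        \<le> ennreal ((1 / 2) ^ n)" by simp
  qed auto
  also have "\<dots> < \<infinity>"
    by (subst suminf_ennreal2) (auto intro: summable_geometric)
  finally have "weighted_modular \<phi> \<gamma> (\<lambda>x. ennreal 1 * u x) < \<infinity>" by simp
  then obtain k where k: "0 < k" and fin: "weighted_modular \<phi> \<gamma> (\<lambda>x. ennreal k * maximal u x) < \<infinity>"
    using I u unfolding maximal_preserves_class_def by (metis zero_less_one)
  obtain A where A: "0 \<le> A" "weighted_modular \<phi> \<gamma> (\<lambda>x. ennreal k * maximal u x) = ennreal A"
    using fin by (cases "weighted_modular \<phi> \<gamma> (\<lambda>x. ennreal k * maximal u x)") auto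
  obtain n where n: "max (1 / k) (A / k) < 2 ^ n"
    using real_arch_pow[of 2 "max (1 / k) (A / k)"] by auto
  define c where "c = (1 / 2) ^ n / k"
  have c: "0 < c" "c \<le> 1" "c * A \<le> 1"
    using n k by (auto simp: c_def field_simps power_divide)
  have "weighted_modular \<phi> \<gamma> (\<lambda>x. ennreal (1 / 4 ^ n) * maximal (v n) x) \<le>
    weighted_modular \<phi> \<gamma> (\<lambda>x. ennreal c * (ennreal k * maximal u x))"
  proof (rule weighted_modular_mono)
    fix x
    have "ennreal ((1 / 2) ^ n) * maximal (v n) x = maximal (\<lambda>x. ennreal ((1 / 2) ^ n) * v n x) x"
      by (simp add: maximal_cmult[OF v])
    also have "\<dots> \<le> maximal u x"
      unfolding u_def by (rule maximal_mono) (rule SUP_upper, simp)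
    finally have "ennreal ((1 / 2) ^ n) * (ennreal ((1 / 2) ^ n) * maximal (v n) x)
        \<le> ennreal ((1 / 2) ^ n) * maximal u x"
      by (rule mult_left_mono) simp
    moreover have "ennreal ((1 / 2) ^ n) * (ennreal ((1 / 2) ^ n) * maximal (v n) x)
        = ennreal (1 / 4 ^ n) * maximal (v n) x"
      by (simp add: mult.assoc[symmetric] ennreal_mult''[symmetric]
          power_mult_distrib[symmetric] power_one_over)
    moreover have "ennreal c * (ennreal k * maximal u x) = ennreal ((1 / 2) ^ n) * maximal u x"
      using k by (simp add: mult.assoc[symmetric] ennreal_mult''[symmetric] c_def)
    ultimately show "ennreal (1 / 4 ^ n) * maximal (v n) x
        \<le> ennreal c * (ennreal k * maximal u x)" by simp
  qed
  also have "\<dots> \<le> ennreal c * ennreal A"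
    using c unfolding A(2)[symmetric] by (intro weighted_modular_shrink[OF mono]) auto
  also have "\<dots> \<le> 1"
    using c A by (simp add: ennreal_mult''[symmetric])
  finally show False using large by blast
qed

text \<open>
The substitution \<open>x \<mapsto> cx\<close> divides the modular by \<open>c\<^sup>1\<^sup>+\<^sup>\<gamma>\<close> and commutes with the maximal
operator. For a function of finite modular, a suitable \<open>c\<close> moves it into the unit ball, where a
bound for the norm is a bound for the modular; undoing the substitution gives the modular
inequality.
\<close>

lemma modular_bound_of_norm_bound:
  assumes \<gamma>: "-1 < \<gamma>" and G: "maximal_norm_bound \<phi> \<gamma>"
  shows "maximal_modular_bound \<phi> \<gamma>"
proof -
  obtain L where L: "0 < L" and bound: "\<And>u. u \<in> borel_measurable borel \<Longrightarrow>
     weighted_norm \<phi> \<gamma> (maximal u) \<le> ennreal L * weighted_norm \<phi> \<gamma> u"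
    using G unfolding maximal_norm_bound_def by blast
  show ?thesis
    unfolding maximal_modular_bound_def
  proof (intro exI[of _ "2 * L"] conjI ballI)
    fix u :: "real \<Rightarrow> ennreal" assume u [measurable]: "u \<in> borel_measurable borel"
    let ?A = "weighted_modular \<phi> \<gamma> (\<lambda>y. ennreal (2 * L) * u y)"
    show "weighted_modular \<phi> \<gamma> (maximal u) \<le> ?A"
    proof (rule ennreal_le_epsilon)
      fix e :: real assume "?A < top" and e: "0 < e"
      then obtain A where A: "0 \<le> A" "?A = ennreal A" by (cases ?A) auto
      \<comment> \<open>A positive number even if the modular vanishes.\<close>
      define \<epsilon> where "\<epsilon> = A + e"
      have \<epsilon>: "0 < \<epsilon>" using A e by (simp add: \<epsilon>_def)
      \<comment> \<open>The dilation by \<open>c\<close> divides the modular by \<open>\<epsilon>\<close>.\<close>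
      define c where "c = \<epsilon> powr (1 / (1 + \<gamma>))"
      have c: "0 < c" "c powr (1 + \<gamma>) = \<epsilon>" using \<epsilon> \<gamma> by (auto simp: c_def powr_powr)
      define v where "v = (\<lambda>x. ennreal (2 * L) * u (c * x))"
      have v [measurable]: "v \<in> borel_measurable borel" unfolding v_def by measurable
      have "ennreal \<epsilon> * weighted_modular \<phi> \<gamma> v = ?A"
        using weighted_modular_dilation[of "\<lambda>y. ennreal (2 * L) * u y" c \<phi> \<gamma>] c by (simp add: v_def)
      also have "\<dots> \<le> ennreal \<epsilon> * 1" using A e by (simp add: \<epsilon>_def ennreal_leI)
      finally have "weighted_modular \<phi> \<gamma> v \<le> 1"
        using \<epsilon> by (subst (asm) ennreal_mult_le_mult_iff) auto
      then have "weighted_norm \<phi> \<gamma> v \<le> ennreal 1" by (intro weighted_norm_le) auto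
      then have "ennreal L * weighted_norm \<phi> \<gamma> v \<le> ennreal L * ennreal 1"
        by (intro mult_left_mono) auto
      also have "\<dots> < ennreal (2 * L)" using L by (simp add: ennreal_less_iff)
      finally have "weighted_norm \<phi> \<gamma> (maximal v) < ennreal (2 * L)"
        using bound[OF v] by (rule le_less_trans[rotated])
      then have v1: "weighted_modular \<phi> \<gamma> (\<lambda>x. ennreal (1 / (2 * L)) * maximal v x) \<le> 1"
        by (rule weighted_modular_le_1_of_norm_less)
      have "weighted_modular \<phi> \<gamma> (\<lambda>x. maximal u (c * x)) \<le>
        weighted_modular \<phi> \<gamma> (\<lambda>x. ennreal (1 / (2 * L)) * maximal v x)"
      proof (rule weighted_modular_mono)
        fix x
        have "maximal v x = ennreal (2 * L) * maximal (\<lambda>y. u (c * y)) x"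
          unfolding v_def by (rule maximal_cmult) simp
        then have "ennreal (1 / (2 * L)) * maximal v x = maximal (\<lambda>y. u (c * y)) x"
          using L by (simp add: mult.assoc[symmetric] ennreal_mult''[symmetric])
        then show "maximal u (c * x) \<le> ennreal (1 / (2 * L)) * maximal v x"
          using maximal_dilation[OF u c(1)] by simp
      qed
      with v1 have "weighted_modular \<phi> \<gamma> (\<lambda>x. maximal u (c * x)) \<le> 1" by (rule order_trans[rotated])
      then have "ennreal \<epsilon> * weighted_modular \<phi> \<gamma> (\<lambda>x. maximal u (c * x)) \<le> ennreal \<epsilon> * 1"
        by (intro mult_left_mono) auto
      then have "weighted_modular \<phi> \<gamma> (maximal u) \<le> ennreal \<epsilon>"
        using weighted_modular_dilation[OF maximal_measurable c(1), of \<phi> \<gamma> u] c by simp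
      then show "weighted_modular \<phi> \<gamma> (maximal u) \<le> ?A + ennreal e"
        using A e by (simp add: \<epsilon>_def ennreal_plus)
    qed
  qed (use L in simp)
qed

section \<open>Growth conditions from the modular inequality\<close>

lemma nn_integral_powr_Ioo:
  assumes "-1 < \<gamma>" "0 \<le> t"
  shows "(\<integral>\<^sup>+ x\<in>{0<..<t}. ennreal (\<bar>x\<bar> powr \<gamma>) \<partial>lborel) = ennreal (t powr (1 + \<gamma>) / (1 + \<gamma>))"
proof -
  have "(\<integral>\<^sup>+ x\<in>{0<..<t}. ennreal (\<bar>x\<bar> powr \<gamma>) \<partial>lborel) =
     (\<integral>\<^sup>+ x. ennreal (indicator {0..t} x * x powr \<gamma>) \<partial>lborel)"
  proof (rule nn_integral_cong_AE)
    have "AE x in lborel. x \<noteq> (0::real)" "AE x in lborel. x \<noteq> t"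
      by (auto intro: AE_lborel_singleton)
    then show "AE x in lborel. ennreal (\<bar>x\<bar> powr \<gamma>) * indicator {0<..<t} x
        = ennreal (indicator {0..t} x * x powr \<gamma>)"
      by eventually_elim (auto simp: indicator_def)
  qed
  also have "\<dots> = ennreal (t powr (\<gamma> + 1) / (\<gamma> + 1))"
    by (rule nn_integral_has_integral_lebesgue)
        (use assms in \<open>auto intro: has_integral_powr_from_0\<close>)
  finally show ?thesis by (simp add: add.commute)
qed

text \<open>
By homogeneity this makes the weight comparable to a constant on every dyadic interval.
\<close>

lemma powr_weight_bounds:
  fixes x \<gamma> :: real
  assumes "1 \<le> x" "x \<le> 2"
  shows "2 powr (- \<bar>\<gamma>\<bar>) \<le> x powr \<gamma>" "x powr \<gamma> \<le> 2 powr \<bar>\<gamma>\<bar>"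
proof -
  have "x powr \<bar>\<gamma>\<bar> \<le> 2 powr \<bar>\<gamma>\<bar>" using assms by (intro powr_mono2) auto
  moreover have "x powr (- \<bar>\<gamma>\<bar>) \<le> x powr \<gamma>" "x powr \<gamma> \<le> x powr \<bar>\<gamma>\<bar>"
    using assms by (auto intro: powr_mono)
  moreover have "2 powr (- \<bar>\<gamma>\<bar>) \<le> x powr (- \<bar>\<gamma>\<bar>)" using assms by (intro powr_mono2') auto
  ultimately show "2 powr (- \<bar>\<gamma>\<bar>) \<le> x powr \<gamma>" "x powr \<gamma> \<le> 2 powr \<bar>\<gamma>\<bar>" by linarith+
qed

text \<open>
The test function is the plateau of height \<open>s = 4t/h\<close> on \<open>(1, 1 + h)\<close>. At \<open>x \<in> [1 + h, 2]\<close> its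
maximal function is at least \<open>2t/(x - 1)\<close>, so convexity bounds \<open>\<Phi>\<close> of it below by
\<open>\<Phi>(2t)/(x - 1)\<close>, with integral \<open>\<Phi>(2t) ln(1/h)\<close>. The modular of \<open>K\<close> times the plateau is about
\<open>h \<Phi>(Ks)\<close>. Comparing the two and choosing \<open>h\<close> so small that the logarithm beats all constants
gives \<open>2 \<phi>(t) \<le> \<phi>(bt)\<close>.
\<close>

lemma doubling_of_modular_bound:
  assumes \<phi>: "young_density \<phi>" and M: "maximal_modular_bound \<phi> \<gamma>"
  shows "\<exists>b>1. \<forall>t>0. 2 * \<phi> t \<le> \<phi> (b * t)"
proof -
  note mono = young_densityD(3)[OF \<phi>]
  obtain K where K: "0 < K" and bound: "\<And>u. u \<in> borel_measurable borel \<Longrightarrow>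
     weighted_modular \<phi> \<gamma> (maximal u) \<le> weighted_modular \<phi> \<gamma> (\<lambda>y. ennreal K * u y)"
    using M unfolding maximal_modular_bound_def by blast
  define W where "W = 2 powr \<bar>\<gamma>\<bar>"
  have W: "1 \<le> W" by (simp add: W_def ge_one_powr_ge_zero)
  \<comment> \<open>The value of \<open>ln(1/h)\<close>, large enough to turn the constants in \<open>main\<close> into a factor 2.\<close>
  define N where "N = 8 * K * W\<^sup>2"
  have N: "0 < N" using K W by (simp add: N_def)
  define h where "h = exp (- N)"
  have h: "0 < h" "h < 1" using N by (auto simp: h_def)
  have main: "N * t * \<phi> t \<le> 2 * K * W\<^sup>2 * (2 * t * \<phi> (4 * K / h * t))" if t: "0 < t" for t
  proof -
    let ?s = "4 * t / h"
    define u where "u = (\<lambda>x::real. ennreal ?s * indicator {1<..<1 + h} x)"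
    have u [measurable]: "u \<in> borel_measurable borel" unfolding u_def by measurable
    have nn: "0 \<le> \<phi> t" "0 \<le> \<phi> (4 * K / h * t)" using young_densityD(1)[OF \<phi>] t h K by auto
    have low: "young_function \<phi> (ennreal (2 * t)) * ennreal (1 / (x - 1))
        \<le> young_function \<phi> (maximal u x)"
      if x: "x \<in> {1 + h..2}" for x
    proof -
      \<comment> \<open>The interval \<open>(1, 2x - 1)\<close> is centred at \<open>x\<close> and contains the whole plateau.\<close>
      have x1: "0 < x - 1" "1 \<le> 1 / (x - 1)" using x h by auto
      have "ennreal (1 / (x - 1)) * ennreal (2 * t) = ennreal (?s * h) / ennreal (2 * x - 1 - 1)"
        using x1 t h by (simp add: divide_ennreal ennreal_mult'[symmetric] field_simps)
      also have "ennreal (?s * h) = (\<integral>\<^sup>+ y. u y * indicator {1<..<2 * x - 1} y \<partial>lborel)"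
      proof -
        have "(\<integral>\<^sup>+ y. u y * indicator {1<..<2 * x - 1} y \<partial>lborel)
            = (\<integral>\<^sup>+ y. ennreal ?s * indicator {1<..<1 + h} y \<partial>lborel)"
          unfolding u_def using x h by (intro nn_integral_cong) (auto simp: indicator_def)
        also have "\<dots> = ennreal ?s * ennreal h" using h by (simp add: nn_integral_cmult_indicator)
        also have "\<dots> = ennreal (?s * h)" by (rule ennreal_mult'[symmetric]) (use t h in simp)
        finally show ?thesis by simp
      qed
      also have "\<dots> / ennreal (2 * x - 1 - 1) \<le> maximal u x"
        by (rule maximal_upper) (use x1 in auto)
      finally have "young_function \<phi> (ennreal (1 / (x - 1)) * ennreal (2 * t))
          \<le> young_function \<phi> (maximal u x)"
        by (rule young_function_mono)
      moreover have "ennreal (1 / (x - 1)) * young_function \<phi> (ennreal (2 * t))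
          \<le> young_function \<phi> (ennreal (1 / (x - 1)) * ennreal (2 * t))"
        by (rule young_function_le_scale[OF mono x1(2)])
      ultimately show ?thesis by (simp add: mult.commute)
    qed
    have "(\<integral>\<^sup>+ x. ennreal (1 / (x - 1)) * indicator {1 + h..2} x \<partial>lborel)
        = ennreal (ln (2 - 1) - ln (1 + h - 1))"
      by (rule nn_integral_FTC_Icc) (use h in \<open>auto intro!: derivative_eq_intros\<close>)
    then have log_integral: "(\<integral>\<^sup>+ x. ennreal (1 / (x - 1)) * indicator {1 + h..2} x \<partial>lborel)
        = ennreal N"
      by (simp add: h_def)
    have "ennreal (t * \<phi> t * N) \<le> young_function \<phi> (ennreal (2 * t)) * ennreal N"
      using young_function_ge[OF mono t] t N nn by (simp add: ennreal_mult'' mult_right_mono)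
    also have "\<dots> = (\<integral>\<^sup>+ x. young_function \<phi> (ennreal (2 * t))
        * (ennreal (1 / (x - 1)) * indicator {1 + h..2} x) \<partial>lborel)"
      unfolding log_integral[symmetric] by (rule nn_integral_cmult[symmetric]) measurable
    also have "\<dots> \<le> (\<integral>\<^sup>+ x. ennreal W * (young_function \<phi> (maximal u x)
        * ennreal (\<bar>x\<bar> powr \<gamma>)) \<partial>lborel)"
    proof (rule nn_integral_mono)
      fix x :: real
      show "young_function \<phi> (ennreal (2 * t)) * (ennreal (1 / (x - 1)) * indicator {1 + h..2} x)
        \<le> ennreal W * (young_function \<phi> (maximal u x) * ennreal (\<bar>x\<bar> powr \<gamma>))"
      proof (cases "x \<in> {1 + h..2}")
        case True
        then have x: "1 < x" "x \<le> 2" using h by auto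
        have "1 / W \<le> \<bar>x\<bar> powr \<gamma>" using powr_weight_bounds(1)[of x \<gamma>] x
          by (simp add: W_def powr_minus_divide)
        then have "1 \<le> ennreal (W * \<bar>x\<bar> powr \<gamma>)" using W by (simp add: field_simps)
        then have "young_function \<phi> (maximal u x) * 1
            \<le> young_function \<phi> (maximal u x) * ennreal (W * \<bar>x\<bar> powr \<gamma>)"
          by (rule mult_left_mono) simp
        then have "young_function \<phi> (maximal u x)
            \<le> ennreal W * (young_function \<phi> (maximal u x) * ennreal (\<bar>x\<bar> powr \<gamma>))"
          using W by (simp add: ennreal_mult' mult.left_commute)
        then show ?thesis using low[OF True] x True by (auto intro: order_trans)
      qed simp
    qed
    also have "\<dots> = ennreal W * weighted_modular \<phi> \<gamma> (maximal u)"
      unfolding weighted_modular_def by (rule nn_integral_cmult) measurable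
    also have "\<dots> \<le> ennreal W * weighted_modular \<phi> \<gamma> (\<lambda>y. ennreal K * u y)"
      by (intro mult_left_mono bound u) simp
    also have "weighted_modular \<phi> \<gamma> (\<lambda>y. ennreal K * u y) \<le>
       (\<integral>\<^sup>+ x. young_function \<phi> (ennreal (K * ?s)) * ennreal W * indicator {1<..<1 + h} x \<partial>lborel)"
      unfolding weighted_modular_def
    proof (rule nn_integral_mono)
      fix x :: real
      show "young_function \<phi> (ennreal K * u x) * ennreal (\<bar>x\<bar> powr \<gamma>)
          \<le> young_function \<phi> (ennreal (K * ?s)) * ennreal W * indicator {1<..<1 + h} x"
      proof (cases "x \<in> {1<..<1 + h}")
        case True
        then have "\<bar>x\<bar> powr \<gamma> \<le> W" using powr_weight_bounds(2)[of x \<gamma>] h by (simp add: W_def)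
        moreover have "ennreal K * u x = ennreal (K * ?s)"
          using True K by (simp add: u_def ennreal_mult' del: times_divide_eq_right)
        ultimately show ?thesis using True by (auto intro!: mult_left_mono ennreal_leI)
      qed (simp add: u_def)
    qed
    also have "\<dots> = young_function \<phi> (ennreal (K * ?s)) * ennreal W * ennreal h"
      using h by (simp add: nn_integral_cmult_indicator)
    also have "\<dots> \<le> ennreal (K * ?s * \<phi> (K * ?s)) * ennreal W * ennreal h"
      using K t h by (intro mult_right_mono young_function_le[OF mono]) auto
    finally have "ennreal (t * \<phi> t * N)
        \<le> ennreal W * (ennreal (K * ?s * \<phi> (K * ?s)) * ennreal W * ennreal h)"
      by (simp add: mult_left_mono)
    also have "\<dots> = ennreal (W * (K * ?s * \<phi> (K * ?s) * W * h))"
      using W h K t nn by (simp add: ennreal_mult''[symmetric] ennreal_mult'[symmetric])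
    finally have "t * \<phi> t * N \<le> W * (K * ?s * \<phi> (K * ?s) * W * h)"
      using W h K t nn by (subst (asm) ennreal_le_iff) (auto simp: field_simps)
    also have "\<dots> = 2 * K * W\<^sup>2 * (2 * t * \<phi> (4 * K / h * t))"
      using h by (simp add: power2_eq_square field_simps)
    finally show ?thesis by (simp add: mult.commute mult.left_commute)
  qed
  have "2 * \<phi> t \<le> \<phi> ((4 * K / h + 1) * t)" if t: "0 < t" for t
  proof -
    have "(4 * K * W\<^sup>2 * t) * (2 * \<phi> t) \<le> (4 * K * W\<^sup>2 * t) * \<phi> (4 * K / h * t)"
      using main[OF t] by (simp add: N_def algebra_simps)
    moreover have "0 < 4 * K * W\<^sup>2 * t" using K W t by simp
    ultimately have "2 * \<phi> t \<le> \<phi> (4 * K / h * t)" by (simp only: mult_le_cancel_left_pos)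
    also have "\<dots> \<le> \<phi> ((4 * K / h + 1) * t)"
      using K h t by (intro young_densityD(2)[OF \<phi>]) (auto simp: algebra_simps)
    finally show ?thesis .
  qed
  moreover have "1 < 4 * K / h + 1" using K h by simp
  ultimately show ?thesis by blast
qed

text \<open>
The density is at most \<open>s\<close> below its generalized inverse at \<open>s\<close>.
\<close>

lemma young_function_le_below_gen_inverse:
  assumes \<phi>: "young_density \<phi>" and s: "0 < s" and r: "r \<le> gen_inverse \<phi> s"
  shows "young_function \<phi> (ennreal r) \<le> ennreal (s * r)"
proof (cases "0 < r")
  case True
  have "young_function \<phi> (ennreal r) \<le> (\<integral>\<^sup>+ x. ennreal s * indicator {0<..<r} x \<partial>lborel)"
    unfolding young_function_def using True r
    by (intro nn_integral_mono)
       (auto simp: indicator_def ennreal_less_iff intro!: ennreal_leI density_below_gen_inverse[OF \<phi> s])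
  also have "\<dots> = ennreal (s * r)"
    using True s by (simp add: nn_integral_cmult_indicator ennreal_mult')
  finally show ?thesis .
qed (simp add: ennreal_neg)

text \<open>
Let \<open>f(x) = \<phi>\<^sup>-\<^sup>1(x\<^sup>-\<^sup>\<gamma>)\<close> on \<open>(0, t)\<close>. The weight cancels the slope of \<open>\<Phi>\<close>, so that
\<open>\<Phi>(f) |x|\<^sup>\<gamma> \<le> f\<close>, and the modular of \<open>f\<close> is at most \<open>t a\<close>, where \<open>a\<close> is the mean of \<open>f\<close> over
\<open>(0, t)\<close>. The maximal function of \<open>f/K\<close> is at least \<open>a/K\<close> on \<open>(0, t)\<close>, whence
\<open>\<Phi>(a/K) t\<^sup>1\<^sup>+\<^sup>\<gamma> \<le> (1 + \<gamma>) t a\<close>. Dividing by \<open>a\<close> leaves a bound for \<open>\<phi>(a/2K)\<close>, which is inverted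
to the desired bound for \<open>a\<close>.
\<close>

lemma average_condition_of_modular_bound:
  assumes \<phi>: "young_density \<phi>" and \<gamma>: "-1 < \<gamma>" and M: "maximal_modular_bound \<phi> \<gamma>"
  shows "\<exists>C\<ge>1. \<forall>t>0. ennreal (1 / t) *
     (\<integral>\<^sup>+ s\<in>{0<..<t}. ennreal (gen_inverse \<phi> (s powr (-\<gamma>))) \<partial>lborel)
     \<le> ennreal (C * gen_inverse \<phi> (C * t powr (-\<gamma>)))"
proof -
  note mono = young_densityD(3)[OF \<phi>]
  obtain K where K: "0 < K" and bound: "\<And>u. u \<in> borel_measurable borel \<Longrightarrow>
     weighted_modular \<phi> \<gamma> (maximal u) \<le> weighted_modular \<phi> \<gamma> (\<lambda>y. ennreal K * u y)"
    using M unfolding maximal_modular_bound_def by blast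
  define C where "C = max 1 (max (2 * K) (2 * K * (1 + \<gamma>)))"
  have C: "1 \<le> C" "2 * K \<le> C" "2 * K * (1 + \<gamma>) \<le> C" by (auto simp: C_def)
  define g where "g = (\<lambda>s. gen_inverse \<phi> (s powr (-\<gamma>)))"
  have g_pos: "0 < g s" if "0 < s" for s
    using that by (auto simp: g_def intro: gen_inverse_pos[OF \<phi>])
  have [measurable]: "(\<lambda>s. g s * indicator {0<..} s) \<in> borel_measurable borel"
    unfolding g_def by (rule gen_inverse_powr_measurable[OF \<phi>])
  \<comment> \<open>Truncation at height \<open>n\<close> makes the mean value finite, so that it can be divided out.\<close>
  have trunc: "ennreal (1 / t) * (\<integral>\<^sup>+ x. ennreal (min (g x * indicator {0<..} x) (real n))
      * indicator {0<..<t} x \<partial>lborel)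
      \<le> ennreal (C * gen_inverse \<phi> (C * t powr (-\<gamma>)))" if t: "0 < t" for n t
  proof -
    define u where "u = (\<lambda>x. ennreal (min (g x * indicator {0<..} x) (real n))
        * indicator {0<..<t} x)"
    have u [measurable]: "u \<in> borel_measurable borel" unfolding u_def by measurable
    have "(\<integral>\<^sup>+ x. u x \<partial>lborel) \<le> (\<integral>\<^sup>+ x. ennreal (real n) * indicator {0<..<t} x \<partial>lborel)"
      unfolding u_def by (intro nn_integral_mono mult_right_mono ennreal_leI) auto
    also have "\<dots> < \<infinity>" using t by (simp add: nn_integral_cmult_indicator ennreal_mult_less_top)
    finally obtain A where A: "0 \<le> A" "(\<integral>\<^sup>+ x. u x \<partial>lborel) = ennreal A"
      by (cases "\<integral>\<^sup>+ x. u x \<partial>lborel") auto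
    define a where "a = A / t"
    have a: "0 \<le> a" using A t by (simp add: a_def)
    have avg: "ennreal (1 / t) * (\<integral>\<^sup>+ x. u x \<partial>lborel) = ennreal a"
      using A t by (simp add: a_def ennreal_mult'[symmetric])
    have "a \<le> C * gen_inverse \<phi> (C * t powr (-\<gamma>))"
    proof (cases "a = 0")
      case True
      then show ?thesis using C t gen_inverse_pos[OF \<phi>, of "C * t powr (-\<gamma>)"] by simp
    next
      case False
      then have a: "0 < a" using a by simp
      let ?r = "a / (2 * K)"
      have r: "0 < ?r" using a K by simp
      have "ennreal (?r * \<phi> ?r) * ennreal (t powr (1 + \<gamma>) / (1 + \<gamma>))
        \<le> young_function \<phi> (ennreal (a / K)) * ennreal (t powr (1 + \<gamma>) / (1 + \<gamma>))"
        using young_function_ge[OF mono r] by (intro mult_right_mono) auto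
      also have "\<dots> = (\<integral>\<^sup>+ x. young_function \<phi> (ennreal (a / K))
          * (ennreal (\<bar>x\<bar> powr \<gamma>) * indicator {0<..<t} x) \<partial>lborel)"
        using nn_integral_powr_Ioo[OF \<gamma>, of t] t by (subst nn_integral_cmult) auto
      also have "\<dots> \<le> weighted_modular \<phi> \<gamma> (maximal (\<lambda>x. ennreal (1 / K) * u x))"
        unfolding weighted_modular_def
      proof (rule nn_integral_mono)
        fix x
        have "ennreal (a / K) \<le> maximal (\<lambda>x. ennreal (1 / K) * u x) x" if x: "x \<in> {0<..<t}"
        proof -
          have "(\<integral>\<^sup>+ y. u y * indicator {0<..<t} y \<partial>lborel) = ennreal A"
            unfolding A(2)[symmetric] u_def by (intro nn_integral_cong) (auto simp: indicator_def)
          then have "ennreal a \<le> maximal u x"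
            using maximal_upper[of 0 x t u] x A t by (simp add: a_def divide_ennreal)
          then have "ennreal (1 / K) * ennreal a \<le> maximal (\<lambda>x. ennreal (1 / K) * u x) x"
            unfolding maximal_cmult[OF u] by (intro mult_left_mono) auto
          then show ?thesis using K a by (simp add: ennreal_mult'[symmetric])
        qed
        then show "young_function \<phi> (ennreal (a / K))
            * (ennreal (\<bar>x\<bar> powr \<gamma>) * indicator {0<..<t} x)
          \<le> young_function \<phi> (maximal (\<lambda>x. ennreal (1 / K) * u x) x) * ennreal (\<bar>x\<bar> powr \<gamma>)"
          by (cases "x \<in> {0<..<t}") (auto intro!: mult_right_mono young_function_mono)
      qed
      also have "\<dots> \<le> weighted_modular \<phi> \<gamma> (\<lambda>x. ennreal K * (ennreal (1 / K) * u x))"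
        by (rule bound) simp
      also have "(\<lambda>x. ennreal K * (ennreal (1 / K) * u x)) = u"
        using K by (simp add: mult.assoc[symmetric] ennreal_mult'[symmetric])
      also have "weighted_modular \<phi> \<gamma> u \<le> (\<integral>\<^sup>+ x. u x \<partial>lborel)"
        unfolding weighted_modular_def
      proof (rule nn_integral_mono)
        fix x
        show "young_function \<phi> (u x) * ennreal (\<bar>x\<bar> powr \<gamma>) \<le> u x"
        proof (cases "x \<in> {0<..<t}")
          case True
          then have x: "0 < x" by simp
          let ?m = "min (g x) (real n)"
          have ux: "u x = ennreal ?m" using True by (simp add: u_def)
          have m: "0 \<le> ?m" using g_pos[OF x] by simp
          have "young_function \<phi> (ennreal ?m) \<le> ennreal (x powr (-\<gamma>) * ?m)"
            by (rule young_function_le_below_gen_inverse[OF \<phi>]) (use x in \<open>auto simp: g_def\<close>)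
          then have "young_function \<phi> (ennreal ?m) * ennreal (\<bar>x\<bar> powr \<gamma>)
              \<le> ennreal (x powr (-\<gamma>) * ?m) * ennreal (\<bar>x\<bar> powr \<gamma>)"
            by (rule mult_right_mono) simp
          also have "\<dots> = ennreal ?m"
            using x m by (simp add: ennreal_mult''[symmetric] powr_minus field_simps)
          finally show ?thesis unfolding ux .
        qed (auto simp: u_def)
      qed
      also have "\<dots> = ennreal (a * t)" using A t by (simp add: a_def)
      finally have "ennreal (?r * \<phi> ?r * (t powr (1 + \<gamma>) / (1 + \<gamma>))) \<le> ennreal (a * t)"
        using \<gamma> by (subst ennreal_mult'') auto
      then have "?r * \<phi> ?r * (t powr (1 + \<gamma>) / (1 + \<gamma>)) \<le> a * t"
        using a t by (subst (asm) ennreal_le_iff) auto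
      then have "(a * t) * (\<phi> ?r * t powr \<gamma>) / (2 * K * (1 + \<gamma>)) \<le> a * t"
        using t by (simp add: powr_add ac_simps)
      then have "(a * t) * (\<phi> ?r * t powr \<gamma>) \<le> (a * t) * (2 * K * (1 + \<gamma>))"
        using K \<gamma> by (subst (asm) pos_divide_le_eq) auto
      then have "\<phi> ?r * t powr \<gamma> \<le> 2 * K * (1 + \<gamma>)"
        using a t by (subst (asm) mult_le_cancel_left_pos) auto
      then have "\<phi> ?r * t powr \<gamma> * t powr (-\<gamma>) \<le> C * t powr (-\<gamma>)"
        using C by (intro mult_right_mono) auto
      then have "\<phi> ?r \<le> C * t powr (-\<gamma>)"
        using t by (simp add: powr_minus field_simps)
      then have "?r \<le> gen_inverse \<phi> (C * t powr (-\<gamma>))" by (rule gen_inverse_upper[OF \<phi> r])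
      then have "a \<le> 2 * K * gen_inverse \<phi> (C * t powr (-\<gamma>))" using K by (simp add: field_simps)
      also have "\<dots> \<le> C * gen_inverse \<phi> (C * t powr (-\<gamma>))"
        using C t gen_inverse_pos[OF \<phi>, of "C * t powr (-\<gamma>)"] by (intro mult_right_mono) auto
      finally show ?thesis .
    qed
    then show ?thesis using avg by (simp add: u_def ennreal_leI)
  qed
  have "ennreal (1 / t) * (\<integral>\<^sup>+ s\<in>{0<..<t}. ennreal (g s) \<partial>lborel)
      \<le> ennreal (C * gen_inverse \<phi> (C * t powr (-\<gamma>)))" if t: "0 < t" for t
  proof -
    have "(\<integral>\<^sup>+ s\<in>{0<..<t}. ennreal (g s) \<partial>lborel) =
      (\<integral>\<^sup>+ x. (SUP n. ennreal (min (g x * indicator {0<..} x) (real n))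
          * indicator {0<..<t} x) \<partial>lborel)"
    proof (rule nn_integral_cong)
      fix x
      show "ennreal (g x) * indicator {0<..<t} x
          = (SUP n. ennreal (min (g x * indicator {0<..} x) (real n)) * indicator {0<..<t} x)"
      proof (cases "x \<in> {0<..<t}")
        case True
        obtain n :: nat where n: "g x \<le> real n" using real_arch_simple by blast
        have "(SUP n. ennreal (min (g x) (real n))) = ennreal (g x)"
          by (rule SUP_eqI) (auto intro!: ennreal_leI, metis UNIV_I min_absorb1 n)
        then show ?thesis using True by simp
      qed simp
    qed
    also have "\<dots> = (SUP n. \<integral>\<^sup>+ x. ennreal (min (g x * indicator {0<..} x) (real n))
        * indicator {0<..<t} x \<partial>lborel)"
    proof (rule nn_integral_monotone_convergence_SUP)
      show "incseq (\<lambda>n x. ennreal (min (g x * indicator {0<..} x) (real n)) * indicator {0<..<t} x)"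
        by (auto simp: incseq_def le_fun_def indicator_def intro!: ennreal_leI)
    qed measurable
    also have "ennreal (1 / t) * \<dots> \<le> ennreal (C * gen_inverse \<phi> (C * t powr (-\<gamma>)))"
      unfolding SUP_mult_left_ennreal by (intro SUP_least trunc t)
    finally show ?thesis .
  qed
  then show ?thesis using C(1) unfolding g_def by blast
qed

section \<open>Growth exponents from the growth conditions\<close>

text \<open>
Up to constants \<open>\<Psi>(t)\<close> is \<open>t \<phi>\<^sup>-\<^sup>1(t)\<close>, where the argument of one of the two has to be doubled;
two applications of the doubling condition absorb this. So \<open>\<phi>\<^sup>-\<^sup>1\<close> is doubling.
\<close>

lemma doubling_of_complementary_doubling:
  assumes \<phi>: "young_density \<phi>" and C: "1 \<le> C"
    and doubling: "\<And>t. 0 < t \<Longrightarrow>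
      complementary_function \<phi> (ennreal (2 * t)) \<le> ennreal C * complementary_function \<phi> (ennreal t)"
    and t: "0 < t"
  shows "2 * \<phi> t \<le> \<phi> ((C\<^sup>2 + 1) * t)"
proof (rule density_growth_of_gen_inverse[OF \<phi>])
  show "gen_inverse \<phi> (2 * s) \<le> C\<^sup>2 / 2 * gen_inverse \<phi> s" if s: "0 < s" for s
  proof -
    let ?\<Psi> = "complementary_function \<phi>" and ?\<psi> = "gen_inverse \<phi>"
    note mono = gen_inverse_mono_on[OF \<phi>]
    have pos: "0 < ?\<psi> s" "0 < ?\<psi> (2 * s)" using s by (auto intro: gen_inverse_pos[OF \<phi>])
    have "ennreal (2 * s * ?\<psi> (2 * s)) \<le> ?\<Psi> (ennreal (2 * (2 * s)))"
      unfolding complementary_function_def using s by (intro young_function_ge mono) auto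
    also have "\<dots> \<le> ennreal C * ?\<Psi> (ennreal (2 * s))" using s by (intro doubling) auto
    also have "\<dots> \<le> ennreal C * (ennreal C * ?\<Psi> (ennreal s))"
      using s by (intro mult_left_mono doubling) auto
    also have "\<dots> \<le> ennreal C * (ennreal C * ennreal (s * ?\<psi> s))"
      unfolding complementary_function_def using s
        by (intro mult_left_mono young_function_le mono) auto
    also have "\<dots> = ennreal (C * (C * (s * ?\<psi> s)))"
      using C by (simp add: ennreal_mult')
    finally have "2 * s * ?\<psi> (2 * s) \<le> C * (C * (s * ?\<psi> s))"
      using C s pos by (subst (asm) ennreal_le_iff) auto
    then have "s * (2 * ?\<psi> (2 * s)) \<le> s * (C\<^sup>2 * ?\<psi> s)"
      by (simp add: power2_eq_square algebra_simps)
    then show ?thesis using s by simp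
  qed
qed (use C t in \<open>auto simp: power2_eq_square intro: add_pos_pos\<close>)

text \<open>
Here \<open>\<phi>\<^sup>-\<^sup>1(2s) \<le> b \<phi>\<^sup>-\<^sup>1(s)\<close>, and the substitution \<open>s \<mapsto> 2s\<close> in the integral defining \<open>\<Psi>\<close> gives
the claim.
\<close>

lemma complementary_doubling_of_doubling:
  assumes \<phi>: "young_density \<phi>" and b: "1 < b"
    and step: "\<And>t. 0 < t \<Longrightarrow> 2 * \<phi> t \<le> \<phi> (b * t)" 
  shows "complementary_function \<phi> (ennreal (2 * t))
      \<le> ennreal (2 * b) * complementary_function \<phi> (ennreal t)"
proof -
  note mono = gen_inverse_mono_on[OF \<phi>]
  note [measurable] = mono_on_positive_measurable[OF mono]
  have "complementary_function \<phi> (ennreal (2 * t))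
      = ennreal 2 * young_function (\<lambda>s. gen_inverse \<phi> (2 * s)) (ennreal t)"
    unfolding complementary_function_def
    using young_function_scale[OF mono, of 2 "ennreal t"] by (simp add: ennreal_mult')
  also have "young_function (\<lambda>s. gen_inverse \<phi> (2 * s)) (ennreal t) \<le>
      (\<integral>\<^sup>+ s. ennreal b * (ennreal (gen_inverse \<phi> s * indicator {0<..} s)
          * indicator {s. ennreal s < ennreal t} s) \<partial>lborel)"
    unfolding young_function_def
  proof (intro nn_integral_mono)
    fix s :: real
    show "ennreal (gen_inverse \<phi> (2 * s)) * indicator {s. 0 < s \<and> ennreal s < ennreal t} s
      \<le> ennreal b * (ennreal (gen_inverse \<phi> s * indicator {0<..} s)
          * indicator {s. ennreal s < ennreal t} s)"
    proof (cases "0 < s")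
      case True
      then have "gen_inverse \<phi> (2 * s) \<le> b * gen_inverse \<phi> s"
        using b by (intro gen_inverse_growth_of_density[OF \<phi> _ _ step]) auto
      then have "ennreal (gen_inverse \<phi> (2 * s)) \<le> ennreal b * ennreal (gen_inverse \<phi> s)"
        using b by (simp add: ennreal_mult'[symmetric] ennreal_leI)
      then show ?thesis by (auto simp: indicator_def)
    qed auto
  qed
  also have "\<dots> = ennreal b * complementary_function \<phi> (ennreal t)"
    unfolding complementary_function_def young_function_indicator by (rule nn_integral_cmult) simp
  finally show ?thesis
    using b by (simp add: ennreal_mult' mult.assoc mult_left_mono)
qed

lemma growth_exponent_pos_of_doubling:
  assumes \<phi>: "young_density \<phi>" and b: "1 < b"
    and step: "\<And>t. 0 < t \<Longrightarrow> 2 * \<phi> t \<le> \<phi> (b * t)"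
  shows "\<exists>q>0. growth_exponent \<phi> q"
proof (intro exI conjI)
  show "0 < log b 2" using b by simp
  show "growth_exponent \<phi> (log b 2)"
    by (rule growth_exponent_of_step[OF \<phi> b]) (use b step in auto)
qed

text \<open>
A reverse mean value inequality for a decreasing function \<open>g\<close> improves itself. In the
application \<open>G t\<close> is the integral of \<open>g\<close> over \<open>(0, t)\<close>, and the inequality says that \<open>t g(t)\<close>
is not much smaller than the integral over the longer interval \<open>(0, ct)\<close>. Hence each of the \<open>n\<close>
dyadic blocks of \<open>(0, 2\<^sup>n t)\<close> contributes a fixed fraction \<open>\<delta>\<close> of \<open>G t\<close>, so that
\<open>(1 + n\<delta>) G(t) \<le> G(2\<^sup>n t)\<close>. The factor \<open>n\<close> is the gain: \<open>v g(vt)\<close> is small compared with \<open>g t\<close>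
for \<open>v\<close> small, rather than merely bounded by a multiple of it.
\<close>

lemma antitone_integral_gain:
  fixes g G :: "real \<Rightarrow> real"
  assumes c: "1 \<le> c" "1 \<le> C" 
    and pos: "\<And>t. 0 < t \<Longrightarrow> 0 < g t"
    and lower: "\<And>s t. 0 \<le> s \<Longrightarrow> s < t \<Longrightarrow> G s + (t - s) * g t \<le> G t"
    and G0: "G 0 = 0"
    and upper: "\<And>t. 0 < t \<Longrightarrow> G t \<le> C * t * g (t / c)"
  obtains v where "0 < v" "v < 1/2" "\<And>t. 0 < t \<Longrightarrow> g (v * t) \<le> 1 / (4 * v) * g t"
proof -
  define \<delta> where "\<delta> = 1 / (2 * C * c)"
  have \<delta>: "0 < \<delta>" using c by (simp add: \<delta>_def)
  have G_mono: "G s \<le> G t" if "0 \<le> s" "s \<le> t" for s t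
  proof (cases "s = t")
    case False
    then show ?thesis using lower[of s t] pos[of t] that
      by (smt (verit) mult_nonneg_nonneg)
  qed simp
  have gain: "(1 + real n * \<delta>) * G t \<le> G (2 ^ n * t)" if t: "0 < t" for n t
  proof (induction n)
    case (Suc n)
    let ?s = "2 ^ n * t"
    have s: "0 < ?s" "t \<le> 2 * ?s" using t
      by (auto intro: order_trans[of _ "1
      * t"] simp: mult.assoc[symmetric] power_Suc[symmetric] simp del: power_Suc)
    have "t \<le> c * (2 * ?s)" using s c by (smt (verit) mult_le_cancel_right1)
    then have "G t \<le> G (c * (2 * ?s))" using t by (intro G_mono) auto
    also have "\<dots> \<le> C * (c * (2 * ?s)) * g (2 * ?s)"
      using upper[of "c * (2 * ?s)"] c s by simp
    finally have "\<delta> * G t \<le> ?s * g (2 * ?s)"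
      using c by (simp add: \<delta>_def field_simps)
    moreover have "G ?s + ?s * g (2 * ?s) \<le> G (2 * ?s)" using lower[of ?s "2 * ?s"] s t
      by (simp add: mult.commute)
    ultimately have "(1 + real n * \<delta>) * G t + \<delta> * G t \<le> G (2 * ?s)" using Suc.IH by linarith
    then show ?case by (simp add: algebra_simps)
  qed simp
  \<comment> \<open>Large enough for the gain \<open>n\<delta>\<close> to beat all constants, and for \<open>v < 1/2\<close>.\<close>
  obtain n where n: "4 * C * c / \<delta> < real n" "2 * c < 2 ^ n"
  proof -
    obtain n1 :: nat where n1: "4 * C * c / \<delta> < real n1" using reals_Archimedean2 by blast
    obtain n2 where n2: "2 * c < 2 ^ n2" using real_arch_pow[of 2 "2 * c"] by auto
    have "2 ^ n2 \<le> (2::real) ^ max n1 n2" by (intro power_increasing) auto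
    moreover have "real n1 \<le> real (max n1 n2)" by simp
    ultimately show thesis using n1 n2 by (intro that[of "max n1 n2"]) linarith+
  qed
  \<comment> \<open>The dyadic factor \<open>2\<^sup>n\<close>, less the loss \<open>c\<close> in the argument of \<open>g\<close>.\<close>
  define v where "v = c / 2 ^ n"
  have v: "0 < v" "v < 1 / 2" using c n by (auto simp: v_def field_simps)
  have "g (v * t) \<le> 1 / (4 * v) * g t" if t: "0 < t" for t
  proof -
    let ?s = "v * t"
    have s: "0 < ?s" using v t by simp
    have "?s * g ?s \<le> G ?s" using lower[of 0 ?s] s G0 by simp
    moreover have "0 < 1 + real n * \<delta>" using \<delta> by (smt (verit) mult_nonneg_nonneg of_nat_0_le_iff)
    ultimately have "(1 + real n * \<delta>) * (?s * g ?s) \<le> (1 + real n * \<delta>) * G ?s"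
      by (intro mult_left_mono) auto
    also have "\<dots> \<le> G (2 ^ n * ?s)" by (rule gain[OF s])
    also have "\<dots> \<le> C * (2 ^ n * ?s) * g (2 ^ n * ?s / c)" using s by (intro upper) auto
    also have "2 ^ n * ?s / c = t" using c by (simp add: v_def)
    also have "2 ^ n * ?s = c * t" by (simp add: v_def)
    finally have le: "(1 + real n * \<delta>) * (?s * g ?s) \<le> C * (c * t) * g t" .
    have "4 * C * c \<le> 1 + real n * \<delta>" using n(1) \<delta> by (simp add: field_simps)
    then have "4 * C * c * (?s * g ?s) \<le> (1 + real n * \<delta>) * (?s * g ?s)"
      using s pos[OF s] by (intro mult_right_mono) auto
    with le have "(C * c * t) * (4 * v * g ?s) \<le> (C * c * t) * g t" by (simp add: algebra_simps)
    then have "4 * v * g ?s \<le> g t" using c t by (subst (asm) mult_le_cancel_left_pos) auto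
    then show ?thesis using v by (simp add: field_simps)
  qed
  then show thesis using that v by blast
qed

text \<open>
With \<open>g(s) = \<phi>\<^sup>-\<^sup>1(s\<^sup>-\<^sup>\<gamma>)\<close> the condition says that the mean of \<open>g\<close> over \<open>(0, t)\<close> is at most
\<open>C g(t/c)\<close>, where \<open>c\<^sup>\<gamma> = C\<close>. The preceding lemma yields \<open>g(vt) \<le> g(t)/(4v)\<close>, which for \<open>\<phi>\<close>
means \<open>v\<^sup>-\<^sup>\<gamma> \<phi>(t) \<le> \<phi>(t/2v)\<close>. The exponent of this step exceeds \<open>\<gamma>\<close> because of the factor 2.
\<close>

lemma growth_exponent_of_average_condition:
  assumes \<phi>: "young_density \<phi>" and \<gamma>: "0 < \<gamma>" and C: "1 \<le> C"
    and avg: "\<And>t. 0 < t \<Longrightarrow> ennreal (1 / t) *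
        (\<integral>\<^sup>+ s\<in>{0<..<t}. ennreal (gen_inverse \<phi> (s powr (-\<gamma>))) \<partial>lborel)
        \<le> ennreal (C * gen_inverse \<phi> (C * t powr (-\<gamma>)))"
  shows "\<exists>q>\<gamma>. growth_exponent \<phi> q"
proof -
  define g where "g = (\<lambda>s. gen_inverse \<phi> (s powr (-\<gamma>)))"
  define G where "G = (\<lambda>t. \<integral>\<^sup>+ s\<in>{0<..<t}. ennreal (g s) \<partial>lborel)"
  define c where "c = C powr (1 / \<gamma>)"
  have c: "1 \<le> c" using C \<gamma> by (auto simp: c_def intro: ge_one_powr_ge_zero)
  have g_pos: "0 < g s" if "0 < s" for s
    using that by (auto simp: g_def intro: gen_inverse_pos[OF \<phi>])
  have g_anti: "g t \<le> g s" if "0 < s" "s \<le> t" for s t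
    using that \<gamma> by (auto simp: g_def intro!: gen_inverse_mono[OF \<phi>] powr_mono2')
  have g_scale: "g (t / c) = gen_inverse \<phi> (C * t powr (-\<gamma>))" if "0 < t" for t
    using that C \<gamma> by (simp add: g_def c_def powr_divide powr_powr powr_minus_divide)
  have [measurable]: "(\<lambda>s. g s * indicator {0<..} s) \<in> borel_measurable borel"
    unfolding g_def by (rule gen_inverse_powr_measurable[OF \<phi>])
  have G_eq: "G t = (\<integral>\<^sup>+ s. ennreal (g s * indicator {0<..} s)
      * indicator {0<..<t} s \<partial>lborel)" for t
    unfolding G_def by (intro nn_integral_cong) (auto simp: indicator_def)
  have G_le: "G t \<le> ennreal (C * t * g (t / c))" if t: "0 < t" for t
  proof -
    have "ennreal t * (ennreal (1 / t) * G t) \<le> ennreal t * ennreal (C * g (t / c))"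
      unfolding g_scale[OF t] using avg[OF t] by (intro mult_left_mono) (auto simp: G_def g_def)
    moreover have "ennreal t * (ennreal (1 / t) * G t) = G t"
      using t by (simp add: mult.assoc[symmetric] ennreal_mult'[symmetric])
    moreover have "ennreal t * ennreal (C * g (t / c)) = ennreal (C * t * g (t / c))"
      using t by (simp add: ennreal_mult'[symmetric] mult.assoc mult.left_commute)
    ultimately show ?thesis by simp
  qed
  have G_fin: "G t < \<infinity>" for t
  proof (cases "0 < t")
    case True
    then show ?thesis using le_less_trans[OF G_le ennreal_less_top] by simp
  qed (auto simp: G_def)
  have G_add: "G s + ennreal ((t - s) * g t) \<le> G t" if "0 \<le> s" "s < t" for s t
  proof -
    have "ennreal ((t - s) * g t) = (\<integral>\<^sup>+ x. ennreal (g t) * indicator {s..<t} x \<partial>lborel)"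
      using that by (simp add: nn_integral_cmult_indicator ennreal_mult'' mult.commute[of "t - s"])
    then have "G s + ennreal ((t - s) * g t) =
      (\<integral>\<^sup>+ x. ennreal (g x * indicator {0<..} x) * indicator {0<..<s} x + ennreal (g t)
          * indicator {s..<t} x \<partial>lborel)"
      unfolding G_eq by (subst nn_integral_add) auto
    also have "\<dots> \<le> (\<integral>\<^sup>+ x. ennreal (g x * indicator {0<..} x) * indicator {0<..<t} x \<partial>lborel)"
    proof (rule nn_integral_mono_AE)
      have "AE x in lborel. x \<noteq> (0::real)" by (rule AE_lborel_singleton)
      then show "AE x in lborel. ennreal (g x * indicator {0<..} x) * indicator {0<..<s} x
          + ennreal (g t) * indicator {s..<t} x
          \<le> ennreal (g x * indicator {0<..} x) * indicator {0<..<t} x"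
        by eventually_elim (use that in \<open>auto simp: indicator_def intro!: ennreal_leI g_anti\<close>)
    qed
    finally show ?thesis unfolding G_eq .
  qed
  have real_G: "ennreal (enn2real (G t)) = G t" for t
    using G_fin[of t] by simp
  obtain v where v: "0 < v" "v < 1 / 2" and gv: "\<And>t. 0 < t \<Longrightarrow> g (v * t) \<le> 1 / (4 * v) * g t"
  proof (rule antitone_integral_gain[of c C g "\<lambda>t. enn2real (G t)"])
    fix s t :: real assume st: "0 \<le> s" "s < t"
    then have "0 \<le> (t - s) * g t" using g_pos[of t] by simp
    then have "ennreal (enn2real (G s) + (t - s) * g t) \<le> ennreal (enn2real (G t))"
      using G_add[OF st] by (simp add: ennreal_plus real_G)
    then show "enn2real (G s) + (t - s) * g t \<le> enn2real (G t)" by (simp add: ennreal_le_iff)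
  next
    fix t :: real assume t: "0 < t"
    then have "0 \<le> C * t * g (t / c)" using C c g_pos[of "t / c"] by simp
    then show "enn2real (G t) \<le> C * t * g (t / c)"
      using enn2real_mono[OF G_le[OF t]] by simp
  qed (use c C g_pos in \<open>auto simp: G_def\<close>)
  have "gen_inverse \<phi> (v powr (-\<gamma>) * s) \<le> 1 / (4 * v) * gen_inverse \<phi> s" if s: "0 < s" for s
  proof -
    let ?t = "s powr (- 1 / \<gamma>)"
    have "?t powr (-\<gamma>) = s" "(v * ?t) powr (-\<gamma>) = v powr (-\<gamma>) * s"
      using s v \<gamma> by (simp_all add: powr_mult powr_powr)
    then show ?thesis using gv[of ?t] s by (simp add: g_def)
  qed
  then have step: "v powr (-\<gamma>) * \<phi> t \<le> \<phi> (1 / (2 * v) * t)" if "0 < t" for t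
    using that v by (intro density_growth_of_gen_inverse[OF \<phi>, where b
        = "1 / (4 * v)"]) (auto simp: field_simps)
  define b where "b = 1 / (2 * v)"
  have b: "1 < b" "b < 1 / v" using v by (auto simp: b_def field_simps)
  define q where "q = log b (v powr (-\<gamma>))"
  have bq: "b powr q = v powr (-\<gamma>)" using b v by (simp add: q_def)
  have "b powr \<gamma> < (1 / v) powr \<gamma>" using b \<gamma> v by (intro powr_less_mono2) auto
  also have "\<dots> = b powr q" using v by (simp add: bq powr_minus_divide powr_divide)
  finally have "\<gamma> < q" using b by (simp add: powr_less_cancel_iff)
  moreover have "growth_exponent \<phi> q"
    using step \<open>\<gamma> < q\<close> \<gamma> b bq by (intro growth_exponent_of_step[OF \<phi>]) (auto simp: b_def)
  ultimately show ?thesis by blast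
qed

section \<open>A weak-type estimate for power weights\<close>

lemma nn_integral_powr_symmetric:
  assumes "-1 < \<beta>" "0 \<le> R"
  shows "(\<integral>\<^sup>+ x\<in>{-R<..<R}. ennreal (\<bar>x\<bar> powr \<beta>) \<partial>lborel) \<le> ennreal (2 * (R powr (1 + \<beta>) / (1 + \<beta>)))"
proof -
  let ?I = "\<integral>\<^sup>+ x\<in>{0<..<R}. ennreal (\<bar>x\<bar> powr \<beta>) \<partial>lborel"
  have "?I = ennreal \<bar>-1\<bar> * (\<integral>\<^sup>+ x. ennreal (\<bar>0 + (-1) * x\<bar> powr \<beta>)
      * indicator {0<..<R} (0 + (-1) * x) \<partial>lborel)"
    by (rule nn_integral_real_affine) auto
  then have refl: "?I = (\<integral>\<^sup>+ x. ennreal (\<bar>x\<bar> powr \<beta>) * indicator {0<..<R} (- x) \<partial>lborel)" by simp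
  have "(\<integral>\<^sup>+ x\<in>{-R<..<R}. ennreal (\<bar>x\<bar> powr \<beta>) \<partial>lborel) \<le>
     (\<integral>\<^sup>+ x. ennreal (\<bar>x\<bar> powr \<beta>) * indicator {0<..<R} x + ennreal (\<bar>x\<bar> powr \<beta>)
         * indicator {0<..<R} (- x) \<partial>lborel)"
    by (intro nn_integral_mono) (auto simp: indicator_def)
  also have "\<dots> = ?I + ?I"
    by (subst nn_integral_add) (auto simp: refl)
  also have "\<dots> = ennreal (2 * (R powr (1 + \<beta>) / (1 + \<beta>)))"
    using nn_integral_powr_Ioo[OF assms] assms by (simp flip: ennreal_plus)
  finally show ?thesis .
qed

text \<open>
For nonpositive \<open>\<beta>\<close> this is the \<open>A\<^sub>1\<close> condition for the power weight. Either the interval keeps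
away from the origin and the weight is essentially constant on it, or its length is comparable
to \<open>R = max(|a|, |b|)\<close> and the integral over all of \<open>(-R, R)\<close> is small enough.
\<close>

lemma powr_weight_integral_le:
  assumes \<beta>: "-1 < \<beta>"
  obtains C where "1 \<le> C"
    "\<And>a b. a < b \<Longrightarrow> (\<integral>\<^sup>+ x\<in>{a<..<b}. ennreal (\<bar>x\<bar> powr \<beta>) \<partial>lborel)
        \<le> ennreal (C * (b - a) * max \<bar>a\<bar> \<bar>b\<bar> powr \<beta>)"
proof
  define C where "C = 2 powr \<bar>\<beta>\<bar> + 4 / (1 + \<beta>)"
  have C1: "2 powr \<bar>\<beta>\<bar> \<le> C" "4 / (1 + \<beta>) \<le> C" using \<beta> by (auto simp: C_def)
  show C: "1 \<le> C" using C1 ge_one_powr_ge_zero[of 2 "\<bar>\<beta>\<bar>"] by simp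
  fix a b :: real assume ab: "a < b"
  define R where "R = max \<bar>a\<bar> \<bar>b\<bar>"
  have R: "0 < R" using ab by (auto simp: R_def)
  show "(\<integral>\<^sup>+ x\<in>{a<..<b}. ennreal (\<bar>x\<bar> powr \<beta>) \<partial>lborel) \<le> ennreal (C * (b - a) * R powr \<beta>)"
  proof (cases "\<forall>x\<in>{a<..<b}. R / 2 \<le> \<bar>x\<bar>")
    case True
    have "\<bar>x\<bar> powr \<beta> \<le> C * R powr \<beta>" if x: "x \<in> {a<..<b}" for x
    proof -
      have x': "R / 2 \<le> \<bar>x\<bar>" "\<bar>x\<bar> \<le> R" using True x by (auto simp: R_def)
      have "(R / \<bar>x\<bar>) powr (-\<beta>) \<le> 2 powr \<bar>- \<beta>\<bar>"
        using x' R by (intro powr_weight_bounds) (auto simp: field_simps)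
      then have "\<bar>x\<bar> powr \<beta> \<le> 2 powr \<bar>\<beta>\<bar> * R powr \<beta>"
        using x' R by (simp add: powr_divide powr_minus field_simps)
      also have "\<dots> \<le> C * R powr \<beta>" by (intro mult_right_mono C1) simp
      finally show ?thesis .
    qed
    then have "(\<integral>\<^sup>+ x\<in>{a<..<b}. ennreal (\<bar>x\<bar> powr \<beta>) \<partial>lborel) \<le>
      (\<integral>\<^sup>+ x. ennreal (C * R powr \<beta>) * indicator {a<..<b} x \<partial>lborel)"
      by (intro nn_integral_mono) (auto simp: indicator_def ennreal_leI)
    also have "\<dots> = ennreal (C * R powr \<beta>) * ennreal (b - a)"
      using ab by (simp add: nn_integral_cmult_indicator)
    also have "\<dots> = ennreal (C * (b - a) * R powr \<beta>)"
      using ab by (subst ennreal_mult''[symmetric]) (auto simp: ac_simps)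
    finally show ?thesis .
  next
    case False
    then have long: "R / 2 \<le> b - a" by (auto simp: R_def max_def split: if_splits)
    have "(\<integral>\<^sup>+ x\<in>{a<..<b}. ennreal (\<bar>x\<bar> powr \<beta>) \<partial>lborel)
        \<le> (\<integral>\<^sup>+ x\<in>{-R<..<R}. ennreal (\<bar>x\<bar> powr \<beta>) \<partial>lborel)"
      by (intro nn_integral_mono) (auto simp: indicator_def R_def)
    also have "\<dots> \<le> ennreal (2 * (R powr (1 + \<beta>) / (1 + \<beta>)))"
      using R by (intro nn_integral_powr_symmetric \<beta>) simp
    also have "\<dots> \<le> ennreal (C * (b - a) * R powr \<beta>)"
    proof (rule ennreal_leI)
      have "2 * (R powr (1 + \<beta>) / (1 + \<beta>)) = 4 / (1 + \<beta>) * (R / 2) * R powr \<beta>"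
        using R \<beta> by (simp add: powr_add field_simps)
      also have "\<dots> \<le> C * (b - a) * R powr \<beta>"
        using C1 C long R \<beta> by (intro mult_right_mono mult_mono) auto
      finally show "2 * (R powr (1 + \<beta>) / (1 + \<beta>)) \<le> C * (b - a) * R powr \<beta>" .
    qed
    finally show ?thesis .
  qed
qed

text \<open>
Countable subadditivity for a family over a countable index set, in the form that matches
additivity for disjoint families.
\<close>

lemma emeasure_UN_le_count_space:
  assumes C: "countable C" and X: "\<And>i. i \<in> C \<Longrightarrow> X i \<in> sets M"
  shows "emeasure M (\<Union>i\<in>C. X i) \<le> (\<integral>\<^sup>+ i. emeasure M (X i) \<partial>count_space C)"
proof -
  have U: "(\<Union>i\<in>C. X i) \<in> sets M" using assms by (intro sets.countable_UN') auto
  have "emeasure M (\<Union>i\<in>C. X i) = (\<integral>\<^sup>+ x. indicator (\<Union>i\<in>C. X i) x \<partial>M)" using U by simp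
  also have "\<dots> \<le> (\<integral>\<^sup>+ x. (\<integral>\<^sup>+ i. indicator (X i) x \<partial>count_space C) \<partial>M)"
  proof (rule nn_integral_mono)
    fix x
    show "indicator (\<Union>i\<in>C. X i) x \<le> (\<integral>\<^sup>+ i. (indicator (X i) x :: ennreal) \<partial>count_space C)"
    proof (cases "x \<in> (\<Union>i\<in>C. X i)")
      case True
      then obtain j where j: "j \<in> C" "x \<in> X j" by blast
      have "(indicator (X j) x :: ennreal) \<le> (\<integral>\<^sup>+ i. indicator (X i) x \<partial>count_space C)"
        by (rule nn_integral_ge_point[OF j(1)])
      then show ?thesis using True j by simp
    qed simp
  qed
  also have "\<dots> = (\<integral>\<^sup>+ i. (\<integral>\<^sup>+ x. indicator (X i) x \<partial>M) \<partial>count_space C)"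
    by (rule nn_integral_count_space_nn_integral) (use C X in auto)
  also have "\<dots> = (\<integral>\<^sup>+ i. emeasure M (X i) \<partial>count_space C)"
    by (intro nn_integral_cong) (use X in auto)
  finally show ?thesis .
qed

text \<open>
A disjoint subfamily of balls whose fivefold enlargements cover everything transports an
inequality for single balls to the union. Vitali's lemma needs bounded radii, which a monotone
limit supplies.
\<close>

lemma Vitali_emeasure_le:
  fixes J :: "('a::euclidean_space \<times> real) set"
  assumes sets: "sets \<mu> = sets borel" "sets \<nu> = sets borel"
    and J: "\<And>x r. (x, r) \<in> J \<Longrightarrow> 0 < r \<and> emeasure \<mu> (ball x (5 * r)) \<le> emeasure \<nu> (ball x r)"
  shows "emeasure \<mu> (\<Union>(x, r)\<in>J. ball x r) \<le> emeasure \<nu> UNIV"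
proof -
  define U where "U = (\<lambda>n::nat. \<Union>(x, r)\<in>{(x, r)\<in>J. r \<le> real n}. ball x r)"
  have U_le: "emeasure \<mu> (U n) \<le> emeasure \<nu> UNIV" for n
  proof -
    define K where "K = {(x, r)\<in>J. r \<le> real n}"
    have S: "U n \<subseteq> (\<Union>i\<in>K. ball (fst i) (snd i))" by (auto simp: U_def K_def)
    have K: "0 < snd i \<and> snd i \<le> real n" if "i \<in> K" for i
      using that J by (auto simp: K_def)
    obtain C where C: "countable C" "C \<subseteq> K"
      "pairwise (\<lambda>i j. disjnt (ball (fst i) (snd i)) (ball (fst j) (snd j))) C"
      "U n \<subseteq> (\<Union>i\<in>C. ball (fst i) (5 * snd i))"
      by (rule Vitali_covering_lemma_balls[OF S K])
    have CJ: "emeasure \<mu> (ball (fst i) (5 * snd i)) \<le> emeasure \<nu> (ball (fst i) (snd i))" if "i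
        \<in> C" for i
      using that C(2) J[of "fst i" "snd i"] by (auto simp: K_def)
    have "emeasure \<mu> (U n) \<le> emeasure \<mu> (\<Union>i\<in>C. ball (fst i) (5 * snd i))"
      by (intro emeasure_mono C) (simp add: sets borel_open open_UN)
    also have "\<dots> \<le> (\<integral>\<^sup>+ i. emeasure \<mu> (ball (fst i) (5 * snd i)) \<partial>count_space C)"
      by (rule emeasure_UN_le_count_space) (simp_all add: C sets)
    also have "\<dots> \<le> (\<integral>\<^sup>+ i. emeasure \<nu> (ball (fst i) (snd i)) \<partial>count_space C)"
      by (intro nn_integral_mono) (simp add: CJ)
    also have "\<dots> = emeasure \<nu> (\<Union>i\<in>C. ball (fst i) (snd i))"
      by (rule emeasure_UN_countable[symmetric])
         (use C(1,3) in \<open>auto simp: sets disjoint_family_on_def pairwise_def disjnt_def\<close>)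
    also have "\<dots> \<le> emeasure \<nu> UNIV" 
      by (intro emeasure_mono) (simp_all add: sets)
    finally show ?thesis .
  qed
  have "(\<Union>(x, r)\<in>J. ball x r) = (\<Union>n. U n)"
    unfolding U_def using real_arch_simple by fastforce
  also have "emeasure \<mu> (\<Union>n. U n) = (SUP n. emeasure \<mu> (U n))"
  proof (rule SUP_emeasure_incseq[symmetric])
    show "range U \<subseteq> sets \<mu>" unfolding sets(1) U_def by (auto intro!: borel_open open_UN)
    show "incseq U" unfolding incseq_def U_def by fastforce
  qed
  also have "\<dots> \<le> emeasure \<nu> UNIV" by (intro SUP_least U_le)
  finally show ?thesis .
qed

text \<open>
Let \<open>I\<close> be the ball and \<open>R\<close> the larger modulus of the endpoints of its fivefold enlargement.
The function \<open>f\<close> is compared with \<open>h(y) = \<kappa> l (|y|/R)\<^sup>-\<^sup>\<alpha>\<close>. Since \<open>\<alpha> < 1\<close>, the constant \<open>\<kappa>\<close> can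
be chosen such that \<open>h\<close> accounts for at most half of the mean of \<open>f\<close> over \<open>I\<close>. The other half
comes from points with \<open>f > h\<close>, and there \<open>f \<le> f\<^sup>p h\<^sup>1\<^sup>-\<^sup>p\<close>. The power of \<open>h\<close> is where the
weight appears: \<open>h\<^sup>1\<^sup>-\<^sup>p\<close> is \<open>(\<kappa> l)\<^sup>1\<^sup>-\<^sup>p (|y|/R)\<^bsup>\<alpha>(p-1)\<^esup>\<close>, at most \<open>(\<kappa> l)\<^sup>1\<^sup>-\<^sup>p (|y|/R)\<^sup>\<gamma>\<close>
because \<open>\<gamma> \<le> \<alpha>(p - 1)\<close>. This plays the part of Hoelder's inequality and of the \<open>A\<^sub>p\<close> condition
in the usual argument, and it keeps only the values of \<open>f\<close> above \<open>\<kappa> l\<close>.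
\<close>

lemma interval_weight_le:
  assumes \<gamma>: "-1 < \<gamma>" and p: "1 \<le> p" and \<alpha>: "0 \<le> \<alpha>" "\<alpha> < 1" "\<gamma> \<le> \<alpha> * (p - 1)"
  obtains C \<kappa> where "0 < C" "0 < \<kappa>"
    "\<And>f l x r. f \<in> borel_measurable borel \<Longrightarrow> (\<And>y. 0 \<le> f y) \<Longrightarrow> 0 < l \<Longrightarrow> 0 < r \<Longrightarrow>
      ennreal (l * (2 * r)) < (\<integral>\<^sup>+ y\<in>ball x r. ennreal (f y) \<partial>lborel) \<Longrightarrow>
      (\<integral>\<^sup>+ y\<in>ball x (5 * r). ennreal (\<bar>y\<bar> powr \<gamma>) \<partial>lborel) \<le>
      (\<integral>\<^sup>+ y\<in>ball x r. ennreal (C * l powr (-p) * ((if \<kappa> * l < f y then f y powr p else 0)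
          * \<bar>y\<bar> powr \<gamma>)) \<partial>lborel)"
proof -
  have "-1 < -\<alpha>" using \<alpha> by simp
  then obtain Ca where Ca: "1 \<le> Ca"
    "\<And>a b. a < b \<Longrightarrow> (\<integral>\<^sup>+ x\<in>{a<..<b}. ennreal (\<bar>x\<bar> powr (-\<alpha>)) \<partial>lborel)
        \<le> ennreal (Ca * (b - a) * max \<bar>a\<bar> \<bar>b\<bar> powr (-\<alpha>))"
    using powr_weight_integral_le by blast
  obtain Cg where Cg: "1 \<le> Cg"
    "\<And>a b. a < b \<Longrightarrow> (\<integral>\<^sup>+ x\<in>{a<..<b}. ennreal (\<bar>x\<bar> powr \<gamma>) \<partial>lborel)
        \<le> ennreal (Cg * (b - a) * max \<bar>a\<bar> \<bar>b\<bar> powr \<gamma>)"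
    using powr_weight_integral_le[OF \<gamma>] by blast
  \<comment> \<open>The enlarged ball has length \<open>10 r\<close>, and the integral of \<open>h\<close> is to be at most \<open>l r\<close>.\<close>
  define \<kappa> where "\<kappa> = 1 / (10 * Ca)"
  define C where "C = 10 * Cg * \<kappa> powr (1 - p)"
  have \<kappa>: "0 < \<kappa>" using Ca by (simp add: \<kappa>_def)
  have C: "0 < C" using Cg \<kappa> by (simp add: C_def)
  show thesis
  proof (rule that[OF C \<kappa>])
    fix f :: "real \<Rightarrow> real" and l x r :: real
    assume [measurable]: "f \<in> borel_measurable borel" and f: "\<And>y. 0 \<le> f y"
      and l: "0 < l" and r: "0 < r"
      and large: "ennreal (l * (2 * r)) < (\<integral>\<^sup>+ y\<in>ball x r. ennreal (f y) \<partial>lborel)"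
    define R where "R = max \<bar>x - 5 * r\<bar> \<bar>x + 5 * r\<bar>"
    have R: "0 < R" using r by (auto simp: R_def)
    have ball5: "ball x (5 * r) = {x - 5 * r<..<x + 5 * r}" by (rule ball_eq_greaterThanLessThan)
    have in_R: "\<bar>y\<bar> \<le> R" if "y \<in> ball x (5 * r)" for y
      using that unfolding ball5 by (auto simp: R_def)
    have sub: "ball x r \<subseteq> ball x (5 * r)" using r by (intro subset_ball) simp
    define h where "h = (\<lambda>y. \<kappa> * l * R powr \<alpha> * \<bar>y\<bar> powr (-\<alpha>))"
    have [measurable]: "h \<in> borel_measurable borel" unfolding h_def by measurable
    have h_int: "(\<integral>\<^sup>+ y\<in>ball x r. ennreal (h y) \<partial>lborel) \<le> ennreal (l * r)"
    proof -
      have "(\<integral>\<^sup>+ y\<in>ball x r. ennreal (h y) \<partial>lborel) \<le>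
        (\<integral>\<^sup>+ y. ennreal (\<kappa> * l * R powr \<alpha>) * (ennreal (\<bar>y\<bar> powr (-\<alpha>))
            * indicator {x - 5 * r<..<x + 5 * r} y) \<partial>lborel)"
        using sub \<kappa> l unfolding ball5
        by (intro nn_integral_mono) (auto simp: indicator_def h_def ennreal_mult'')
      also have "\<dots> = ennreal (\<kappa> * l * R powr \<alpha>)
          * (\<integral>\<^sup>+ y\<in>{x - 5 * r<..<x + 5 * r}. ennreal (\<bar>y\<bar> powr (-\<alpha>)) \<partial>lborel)"
        by (rule nn_integral_cmult) measurable
      also have "\<dots> \<le> ennreal (\<kappa> * l * R powr \<alpha>) * ennreal (Ca * (10 * r) * R powr (-\<alpha>))"
        using Ca(2)[of "x - 5 * r" "x + 5 * r"] r by (intro mult_left_mono) (auto simp: R_def)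
      also have "\<dots> = ennreal (\<kappa> * l * R powr \<alpha> * (Ca * (10 * r) * R powr (-\<alpha>)))"
        using \<kappa> l by (intro ennreal_mult'[symmetric]) simp
      also have "\<kappa> * l * R powr \<alpha> * (Ca * (10 * r) * R powr (-\<alpha>)) = l * r"
        using Ca R by (simp add: \<kappa>_def powr_minus field_simps)
      finally show ?thesis .
    qed
    define F where "F = (\<lambda>y. (if \<kappa> * l < f y then f y powr p else 0) * \<bar>y\<bar> powr \<gamma>)"
    have [measurable]: "F \<in> borel_measurable borel" unfolding F_def by measurable
    have FB: "(\<lambda>y. ennreal (F y) * indicator (ball x r) y) \<in> borel_measurable lborel"
      by (intro borel_measurable_times_ennreal borel_measurable_indicator) simp_all
    define c where "c = (\<kappa> * l) powr (1 - p) * R powr (-\<gamma>)"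
    have c: "0 \<le> c" by (simp add: c_def)
    have pointwise: "f y \<le> h y + c * F y" if y: "y \<in> ball x r" "y \<noteq> 0" for y
    proof (cases "f y \<le> h y")
      case True
      moreover have "0 \<le> c * F y" using c by (simp add: F_def)
      ultimately show ?thesis by linarith
    next
      case False
      have yR: "0 < \<bar>y\<bar> / R" "\<bar>y\<bar> / R \<le> 1" using y in_R sub R by (auto simp: field_simps)
      have h_eq: "h y = \<kappa> * l * (\<bar>y\<bar> / R) powr (-\<alpha>)"
        using R by (simp add: h_def powr_divide powr_minus field_simps)
      have "1 \<le> (\<bar>y\<bar> / R) powr (-\<alpha>)" using powr_mono2'[of "-\<alpha>" "\<bar>y\<bar> / R" 1] yR \<alpha> by simp
      then have h_ge: "\<kappa> * l \<le> h y" using \<kappa> l by (simp add: h_eq)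
      have h_pos: "0 < h y" using h_ge \<kappa> l by (smt (verit) mult_pos_pos)
      have "(h y) powr (p - 1) \<le> (f y) powr (p - 1)" using False h_pos p by (intro powr_mono2) auto
      then have "(h y) powr (p - 1) * h y powr (1 - p) \<le> f y powr (p - 1) * h y powr (1 - p)"
        by (rule mult_right_mono) simp
      moreover have "(h y) powr (p - 1) * h y powr (1 - p) = 1"
        using h_pos by (simp add: powr_add[symmetric])
      ultimately have "1 \<le> f y powr (p - 1) * h y powr (1 - p)" by simp
      then have "f y * 1 \<le> f y * (f y powr (p - 1) * h y powr (1 - p))"
        using f by (intro mult_left_mono) auto
      also have "\<dots> = f y powr p * h y powr (1 - p)"
        using False h_pos by (simp add: powr_diff)
      also have "h y powr (1 - p) = (\<kappa> * l) powr (1 - p) * (\<bar>y\<bar> / R) powr (\<alpha> * (p - 1))"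
      proof -
        have "h y powr (1 - p) = (\<kappa> * l) powr (1 - p) * (\<bar>y\<bar> / R) powr ((-\<alpha>) * (1 - p))"
          unfolding h_eq using \<kappa> l by (simp add: powr_mult powr_powr)
        then show ?thesis by (simp add: algebra_simps)
      qed
      also have "f y powr p * \<dots> \<le> f y powr p * ((\<kappa> * l) powr (1 - p) * (\<bar>y\<bar> / R) powr \<gamma>)"
        using yR \<alpha> by (intro mult_left_mono powr_mono') auto
      also have "\<dots> = c * F y"
        using False h_ge R by (simp add: c_def F_def powr_divide powr_minus field_simps)
      finally show ?thesis using h_pos by simp
    qed
    have "ennreal (l * r) + ennreal (l * r) = ennreal (l * (2 * r))" using l r
      by (simp flip: ennreal_plus)
    also have "\<dots> \<le> (\<integral>\<^sup>+ y\<in>ball x r. ennreal (f y) \<partial>lborel)" using large by simp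
    also have "\<dots> \<le> (\<integral>\<^sup>+ y. ennreal (h y) * indicator (ball x r) y + ennreal c
        * (ennreal (F y) * indicator (ball x r) y) \<partial>lborel)"
    proof (rule nn_integral_mono_AE)
      have "AE y in lborel. y \<noteq> (0::real)" by (rule AE_lborel_singleton)
      then show "AE y in lborel. ennreal (f y) * indicator (ball x r) y \<le>
        ennreal (h y) * indicator (ball x r) y + ennreal c
            * (ennreal (F y) * indicator (ball x r) y)"
      proof eventually_elim
        case (elim y)
        show ?case
        proof (cases "y \<in> ball x r")
          case True
          have "0 \<le> h y" "0 \<le> F y" using \<kappa> l by (auto simp: h_def F_def)
          then have "ennreal (h y) + ennreal c * ennreal (F y) = ennreal (h y + c * F y)"
            using c by (simp add: ennreal_mult' ennreal_plus)
          then show ?thesis using pointwise[OF True elim] True by (simp add: ennreal_leI)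
        qed simp
      qed
    qed
    also have "\<dots> = (\<integral>\<^sup>+ y\<in>ball x r. ennreal (h y) \<partial>lborel) + ennreal c
        * (\<integral>\<^sup>+ y\<in>ball x r. ennreal (F y) \<partial>lborel)"
    proof -
      have "(\<integral>\<^sup>+ y. ennreal c * (ennreal (F y) * indicator (ball x r) y) \<partial>lborel)
          = ennreal c * (\<integral>\<^sup>+ y\<in>ball x r. ennreal (F y) \<partial>lborel)"
        by (rule nn_integral_cmult[OF FB])
      moreover have "(\<lambda>y. ennreal (h y) * indicator (ball x r) y) \<in> borel_measurable lborel"
        "(\<lambda>y. ennreal c * (ennreal (F y) * indicator (ball x r) y)) \<in> borel_measurable lborel"
        by (intro borel_measurable_times_ennreal borel_measurable_indicator; simp)+
      ultimately show ?thesis by (subst nn_integral_add) simp_all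
    qed
    also have "\<dots> \<le> ennreal (l * r) + ennreal c * (\<integral>\<^sup>+ y\<in>ball x r. ennreal (F y) \<partial>lborel)"
      by (intro add_right_mono h_int)
    finally have lower: "ennreal (l * r) \<le> ennreal c * (\<integral>\<^sup>+ y\<in>ball x r. ennreal (F y) \<partial>lborel)"
      by (simp add: ennreal_add_left_cancel_le)
    have "(\<integral>\<^sup>+ y\<in>ball x (5 * r). ennreal (\<bar>y\<bar> powr \<gamma>) \<partial>lborel) \<le> ennreal (Cg * (10 * r) * R powr \<gamma>)"
      using Cg(2)[of "x - 5 * r" "x + 5 * r"] r by (simp add: ball5 R_def)
    also have "\<dots> = ennreal (10 * Cg * R powr \<gamma> / l) * ennreal (l * r)"
      using Cg l r by (subst ennreal_mult'[symmetric]) (auto simp: field_simps)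
    also have "\<dots> \<le> ennreal (10 * Cg * R powr \<gamma> / l)
        * (ennreal c * (\<integral>\<^sup>+ y\<in>ball x r. ennreal (F y) \<partial>lborel))"
      by (intro mult_left_mono lower) simp
    also have "\<dots> = ennreal (10 * Cg * R powr \<gamma> / l * c) * (\<integral>\<^sup>+ y\<in>ball x r. ennreal (F y) \<partial>lborel)"
      using c by (simp only: ennreal_mult''[OF c] mult.assoc)
    also have "10 * Cg * R powr \<gamma> / l * c = C * l powr (-p)"
    proof -
      have l_split: "l powr (1 - p) = l * l powr (-p)" using l by (simp add: powr_mult_base)
      have R_cancel: "R powr \<gamma> * R powr (-\<gamma>) = 1" using R by (simp add: powr_add[symmetric])
      have "10 * Cg * R powr \<gamma> / l * c
          = 10 * Cg * (\<kappa> powr (1 - p) * (l * l powr (-p))) / l * (R powr \<gamma> * R powr (-\<gamma>))"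
        using \<kappa> l by (simp add: c_def powr_mult l_split)
      also have "\<dots> = C * l powr (-p)" unfolding R_cancel using l by (simp add: C_def)
      finally show ?thesis .
    qed
    also have "ennreal (C * l powr (-p)) * (\<integral>\<^sup>+ y\<in>ball x r. ennreal (F y) \<partial>lborel) =
      (\<integral>\<^sup>+ y. ennreal (C * l powr (-p)) * (ennreal (F y) * indicator (ball x r) y) \<partial>lborel)"
      by (rule nn_integral_cmult[OF FB, symmetric])
    also have "\<dots> = (\<integral>\<^sup>+ y\<in>ball x r. ennreal (C * l powr (-p) * F y) \<partial>lborel)"
      using C by (simp add: ennreal_mult' mult.assoc)
    finally show "(\<integral>\<^sup>+ y\<in>ball x (5 * r). ennreal (\<bar>y\<bar> powr \<gamma>) \<partial>lborel) \<le>
      (\<integral>\<^sup>+ y\<in>ball x r. ennreal (C * l powr (-p) * ((if \<kappa> * l < f y then f y powr p else 0)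
          * \<bar>y\<bar> powr \<gamma>)) \<partial>lborel)"
      unfolding F_def .
  qed
qed

text \<open>
The superlevel set is covered by the balls on which the mean of \<open>f\<close> exceeds \<open>l\<close>, and Vitali's
lemma adds up the estimate for single balls.
\<close>

lemma maximal_weak_type:
  assumes \<gamma>: "-1 < \<gamma>" and p: "1 \<le> p" and \<alpha>: "0 \<le> \<alpha>" "\<alpha> < 1" "\<gamma> \<le> \<alpha> * (p - 1)"
  obtains C \<kappa> where "0 < C" "0 < \<kappa>"
    "\<And>f l. f \<in> borel_measurable borel \<Longrightarrow> (\<And>y. 0 \<le> f y) \<Longrightarrow> 0 < l \<Longrightarrow>
      (\<integral>\<^sup>+ x\<in>{x. ennreal l < maximal (\<lambda>y. ennreal (f y)) x}. ennreal (\<bar>x\<bar> powr \<gamma>) \<partial>lborel) \<le>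
      (\<integral>\<^sup>+ y. ennreal (C * l powr (-p) * ((if \<kappa> * l < f y then f y powr p else 0)
          * \<bar>y\<bar> powr \<gamma>)) \<partial>lborel)"
proof -
  obtain C \<kappa> where C: "0 < C" "0 < \<kappa>"
    and bound: "\<And>f l x r. f \<in> borel_measurable borel \<Longrightarrow> (\<And>y. 0 \<le> f y) \<Longrightarrow> 0 < l \<Longrightarrow> 0 < r \<Longrightarrow>
      ennreal (l * (2 * r)) < (\<integral>\<^sup>+ y\<in>ball x r. ennreal (f y) \<partial>lborel) \<Longrightarrow>
      (\<integral>\<^sup>+ y\<in>ball x (5 * r). ennreal (\<bar>y\<bar> powr \<gamma>) \<partial>lborel) \<le>
      (\<integral>\<^sup>+ y\<in>ball x r. ennreal (C * l powr (-p) * ((if \<kappa> * l < f y then f y powr p else 0)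
          * \<bar>y\<bar> powr \<gamma>)) \<partial>lborel)"
    by (rule interval_weight_le[OF assms]) blast
  show thesis
  proof (rule that[OF C])
    fix f :: "real \<Rightarrow> real" and l :: real
    assume f_meas [measurable]: "f \<in> borel_measurable borel" and f: "\<And>y. 0 \<le> f y" and l: "0 < l"
    let ?w = "\<lambda>x. ennreal (\<bar>x\<bar> powr \<gamma>)"
    let ?F = "\<lambda>y. ennreal (C * l powr (-p) * ((if \<kappa> * l < f y then f y powr p else 0)
        * \<bar>y\<bar> powr \<gamma>))"
    define J where "J = {(x, r). 0 < r \<and>
      ennreal (l * (2 * r)) < (\<integral>\<^sup>+ y\<in>ball x r. ennreal (f y) \<partial>lborel)}"
    have "{x. ennreal l < maximal (\<lambda>y. ennreal (f y)) x} \<subseteq> (\<Union>(x, r)\<in>J. ball x r)"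
    proof
      fix x assume "x \<in> {x. ennreal l < maximal (\<lambda>y. ennreal (f y)) x}"
      then obtain a b where ab: "a < x" "x < b"
        "ennreal l < (\<integral>\<^sup>+ y\<in>{a<..<b}. ennreal (f y) \<partial>lborel) / ennreal (b - a)"
        by (auto simp: less_maximal_iff)
      have ball: "ball ((a + b) / 2) ((b - a) / 2) = {a<..<b}"
        unfolding ball_eq_greaterThanLessThan by (auto simp: field_simps)
      have "ennreal l * ennreal (b - a) < (\<integral>\<^sup>+ y\<in>{a<..<b}. ennreal (f y) \<partial>lborel)"
        using ab divide_ennreal_le_iff[of "b - a" _ "ennreal l"] by (simp add: not_le[symmetric])
      moreover have eq: "ennreal (l * (2 * ((b - a) / 2))) = ennreal l * ennreal (b - a)"
      proof -
        have "2 * ((b - a) / 2) = b - a" by simp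
        then show ?thesis using l by (simp only: ennreal_mult'[OF less_imp_le])
      qed
      ultimately have "((a + b) / 2, (b - a) / 2) \<in> J"
        unfolding J_def mem_Collect_eq prod.case ball eq using ab by simp
      then show "x \<in> (\<Union>(x, r)\<in>J. ball x r)" using ab ball by fastforce
    qed
    then have "(\<integral>\<^sup>+ x\<in>{x. ennreal l < maximal (\<lambda>y. ennreal (f y)) x}. ?w x \<partial>lborel) \<le>
      (\<integral>\<^sup>+ x. ?w x * indicator (\<Union>(x, r)\<in>J. ball x r) x \<partial>lborel)"
      by (intro nn_integral_mono mult_left_mono) (auto simp: indicator_def)
    also have "\<dots> = emeasure (density lborel ?w) (\<Union>(x, r)\<in>J. ball x r)"
      by (rule emeasure_density[symmetric]) (auto intro!: borel_open open_UN)
    also have "\<dots> \<le> emeasure (density lborel ?F) UNIV"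
    proof (rule Vitali_emeasure_le)
      fix x r assume "(x, r) \<in> J"
      then have r: "0 < r"
        and large: "ennreal (l * (2 * r)) < (\<integral>\<^sup>+ y\<in>ball x r. ennreal (f y) \<partial>lborel)"
        by (auto simp: J_def)
      show "0 < r \<and> emeasure (density lborel ?w) (ball x (5 * r))
          \<le> emeasure (density lborel ?F) (ball x r)"
        using bound[OF f_meas f l r large] r by (simp add: emeasure_density)
    qed auto
    also have "\<dots> = (\<integral>\<^sup>+ y. ?F y \<partial>lborel)" by (subst emeasure_density) auto
    finally show "(\<integral>\<^sup>+ x\<in>{x. ennreal l < maximal (\<lambda>y. ennreal (f y)) x}. ?w x \<partial>lborel)
        \<le> (\<integral>\<^sup>+ y. ?F y \<partial>lborel)" .
  qed
qed

section \<open>The modular inequality from a growth exponent\<close>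

text \<open>
The growth exponent bounds \<open>\<phi>(r)\<close> by a multiple of \<open>(r/s)\<^sup>q \<phi>(s)\<close>, and \<open>r\<^bsup>q-p\<^esup>\<close> is integrable
at 0 because \<open>p - 1 < q\<close>.
\<close>

lemma density_kernel_le:
  assumes \<phi>: "young_density \<phi>" and k: "0 < k" and q: "0 < q - p + 1"
    and growth: "\<And>c t. 1 \<le> c \<Longrightarrow> 0 < t \<Longrightarrow> k * c powr q * \<phi> t \<le> \<phi> (c * t)"
    and s: "0 < s"
  shows "(\<integral>\<^sup>+ r\<in>{0<..<s}. ennreal (\<phi> r * r powr (-p)) \<partial>lborel)
    \<le> ennreal (1 / (k * (q - p + 1)) * (s powr (1 - p) * \<phi> s))"
proof -
  let ?c = "1 / k * s powr (-q) * \<phi> s"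
  have \<phi>s: "0 \<le> \<phi> s" by (rule young_densityD(1)[OF \<phi> s])
  then have c: "0 \<le> ?c" using k by simp
  have "(\<integral>\<^sup>+ r\<in>{0<..<s}. ennreal (\<phi> r * r powr (-p)) \<partial>lborel) \<le>
    (\<integral>\<^sup>+ r. ennreal ?c * (ennreal (\<bar>r\<bar> powr (q - p)) * indicator {0<..<s} r) \<partial>lborel)"
  proof (rule nn_integral_mono)
    fix r :: real
    show "ennreal (\<phi> r * r powr (-p)) * indicator {0<..<s} r
        \<le> ennreal ?c * (ennreal (\<bar>r\<bar> powr (q - p)) * indicator {0<..<s} r)"
    proof (cases "r \<in> {0<..<s}")
      case True
      then have r: "0 < r" "r < s" by auto
      have "k * (s / r) powr q * \<phi> r \<le> \<phi> s" using growth[of "s / r" r] r by simp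
      then have "\<phi> r * (k * s powr q) \<le> \<phi> s * r powr q" using r
        by (simp add: powr_divide field_simps)
      then have "\<phi> r \<le> ?c * r powr q"
        using k s by (simp add: powr_minus field_simps)
      then have "\<phi> r * r powr (-p) \<le> ?c * r powr q * r powr (-p)" by (rule mult_right_mono) simp
      also have "\<dots> = ?c * \<bar>r\<bar> powr (q - p)" using r by (simp add: powr_diff powr_minus field_simps)
      finally show ?thesis using True c by (simp add: ennreal_leI ennreal_mult'[symmetric])
    qed simp
  qed
  also have "\<dots> = ennreal ?c * (\<integral>\<^sup>+ r\<in>{0<..<s}. ennreal (\<bar>r\<bar> powr (q - p)) \<partial>lborel)"
    by (rule nn_integral_cmult) measurable
  also have "\<dots> = ennreal ?c * ennreal (s powr (1 + (q - p)) / (1 + (q - p)))"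
    using q s by (subst nn_integral_powr_Ioo) auto
  also have "\<dots> = ennreal (?c * (s powr (1 + (q - p)) / (1 + (q - p))))"
    using c by (rule ennreal_mult'[symmetric])
  also have "?c * (s powr (1 + (q - p)) / (1 + (q - p)))
      = 1 / (k * (q - p + 1)) * (s powr (1 - p) * \<phi> s)"
  proof -
    have "s powr (-q) * s powr (1 + (q - p)) = s powr (1 - p)" using s
      by (simp add: powr_add[symmetric])
    then have "?c * (s powr (1 + (q - p)) / (1 + (q - p)))
        = 1 / k * \<phi> s * s powr (1 - p) / (1 + (q - p))"
      by (metis (no_types, opaque_lifting) mult.assoc mult.commute times_divide_eq_right)
    then show ?thesis by (simp add: add.commute ac_simps)
  qed
  finally show ?thesis .
qed

lemma weighted_modular_layer_cake:
  assumes \<phi>: "young_density \<phi>" and [measurable]: "v \<in> borel_measurable borel"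
  shows "weighted_modular \<phi> \<gamma> v = (\<integral>\<^sup>+ s. ennreal (\<phi> s * indicator {0<..} s) *
     (\<integral>\<^sup>+ x\<in>{x. ennreal s < v x}. ennreal (\<bar>x\<bar> powr \<gamma>) \<partial>lborel) \<partial>lborel)"
proof -
  note [measurable] = mono_on_positive_measurable[OF young_densityD(3)[OF \<phi>]]
  let ?\<phi> = "\<lambda>s. ennreal (\<phi> s * indicator {0<..} s)"
  let ?w = "\<lambda>x. ennreal (\<bar>x\<bar> powr \<gamma>)"
  have "weighted_modular \<phi> \<gamma> v
      = (\<integral>\<^sup>+ x. (\<integral>\<^sup>+ s. ?\<phi> s * (if ennreal s < v x then ?w x else 0) \<partial>lborel) \<partial>lborel)"
    unfolding weighted_modular_def young_function_indicator
  proof (intro nn_integral_cong)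
    fix x
    have "(\<integral>\<^sup>+ s. ?\<phi> s * indicator {s. ennreal s < v x} s \<partial>lborel) * ?w x =
      (\<integral>\<^sup>+ s. ?\<phi> s * indicator {s. ennreal s < v x} s * ?w x \<partial>lborel)"
      by (rule nn_integral_multc[symmetric]) measurable
    also have "\<dots> = (\<integral>\<^sup>+ s. ?\<phi> s * (if ennreal s < v x then ?w x else 0) \<partial>lborel)"
      by (intro nn_integral_cong) (auto simp: indicator_def)
    finally show "(\<integral>\<^sup>+ s. ?\<phi> s * indicator {s. ennreal s < v x} s \<partial>lborel) * ?w x = \<dots>" .
  qed
  also have "\<dots> = (\<integral>\<^sup>+ s. (\<integral>\<^sup>+ x. ?\<phi> s * (if ennreal s < v x then ?w x else 0) \<partial>lborel) \<partial>lborel)"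
    by (rule lborel_pair.Fubini'[symmetric]) measurable
  also have "\<dots> = (\<integral>\<^sup>+ s. ?\<phi> s * (\<integral>\<^sup>+ x. (if ennreal s < v x then ?w x else 0) \<partial>lborel) \<partial>lborel)"
    by (intro nn_integral_cong nn_integral_cmult) measurable
  also have "\<dots> = (\<integral>\<^sup>+ s. ?\<phi> s * (\<integral>\<^sup>+ x\<in>{x. ennreal s < v x}. ?w x \<partial>lborel) \<partial>lborel)"
    by (intro nn_integral_cong arg_cong2[where f = "(*)"] refl) (auto simp: indicator_def)
  finally show ?thesis .
qed

text \<open>
Inserting the weak-type estimate into the layer-cake formula and exchanging the integrals
leaves, at each point \<open>y\<close>, a multiple of \<open>f\<^sup>p\<close> times the integral of \<open>\<phi>(s) s\<^sup>-\<^sup>p\<close> up to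
\<open>r = f/\<kappa>\<close>. The latter is at most a multiple of \<open>r\<^sup>1\<^sup>-\<^sup>p \<phi>(r)\<close>, so what remains is
\<open>r \<phi>(r) \<le> \<Phi>(2r)\<close>. The constant in front is moved inside \<open>\<Phi>\<close> by convexity.
\<close>

lemma modular_bound_real:
  assumes \<phi>: "young_density \<phi>" and \<gamma>: "-1 < \<gamma>" and q: "max \<gamma> 0 < q" "growth_exponent \<phi> q"
  obtains K where "0 < K"
    "\<And>f. f \<in> borel_measurable borel \<Longrightarrow> (\<And>y. 0 \<le> f y) \<Longrightarrow>
      weighted_modular \<phi> \<gamma> (maximal (\<lambda>y. ennreal (f y)))
          \<le> weighted_modular \<phi> \<gamma> (\<lambda>y. ennreal K * ennreal (f y))"
proof -
  note mono = young_densityD(3)[OF \<phi>]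
  note [measurable] = mono_on_positive_measurable[OF mono]
  obtain k where k: "0 < k" and growth: "\<And>c t. 1 \<le> c \<Longrightarrow> 0 < t \<Longrightarrow> k * c powr q * \<phi> t \<le> \<phi> (c * t)"
    using q(2) unfolding growth_exponent_def by blast
  define m where "m = max \<gamma> 0"
  \<comment> \<open>Any \<open>p - 1\<close> strictly between \<open>max(\<gamma>, 0)\<close> and \<open>q\<close> would do.\<close>
  define p where "p = 1 + (m + q) / 2"
  \<comment> \<open>The least \<open>\<alpha>\<close> with \<open>max(\<gamma>, 0) \<le> \<alpha>(p - 1)\<close>; it is below 1 because \<open>m < p - 1\<close>.\<close>
  define \<alpha> where "\<alpha> = m / (p - 1)"
  have m: "0 \<le> m" "\<gamma> \<le> m" "m < q" using q by (auto simp: m_def)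
  have p: "1 < p" "m < p - 1" "0 < q - p + 1" using m by (auto simp: p_def field_simps)
  have \<alpha>: "0 \<le> \<alpha>" "\<alpha> < 1" "\<gamma> \<le> \<alpha> * (p - 1)" using m p by (auto simp: \<alpha>_def)
  obtain C \<kappa> where C: "0 < C" "0 < \<kappa>"
    and weak: "\<And>f l. f \<in> borel_measurable borel \<Longrightarrow> (\<And>y. 0 \<le> f y) \<Longrightarrow> 0 < l \<Longrightarrow>
      (\<integral>\<^sup>+ x\<in>{x. ennreal l < maximal (\<lambda>y. ennreal (f y)) x}. ennreal (\<bar>x\<bar> powr \<gamma>) \<partial>lborel) \<le>
      (\<integral>\<^sup>+ y. ennreal (C * l powr (-p) * ((if \<kappa> * l < f y then f y powr p else 0)
          * \<bar>y\<bar> powr \<gamma>)) \<partial>lborel)"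
    by (rule maximal_weak_type[OF \<gamma> _ \<alpha>]) (use p in auto)
  define D where "D = 1 / (k * (q - p + 1))"
  have D: "0 < D" using k p by (simp add: D_def)
  define E where "E = max 1 (C * D * \<kappa> powr p)"
  show thesis
  proof (rule that[of "E * (2 / \<kappa>)"])
    show "0 < E * (2 / \<kappa>)" using C by (simp add: E_def)
    fix f :: "real \<Rightarrow> real" assume f_meas [measurable]: "f \<in> borel_measurable borel"
      and f: "\<And>y. 0 \<le> f y"
    let ?\<phi> = "\<lambda>s. ennreal (\<phi> s * indicator {0<..} s)"
    let ?w = "\<lambda>x. ennreal (\<bar>x\<bar> powr \<gamma>)"
    let ?F = "\<lambda>s y. ennreal (C * s powr (-p) * ((if \<kappa> * s < f y then f y powr p else 0)
        * \<bar>y\<bar> powr \<gamma>))"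
    have "weighted_modular \<phi> \<gamma> (maximal (\<lambda>y. ennreal (f y))) =
      (\<integral>\<^sup>+ s. ?\<phi> s * (\<integral>\<^sup>+ x\<in>{x. ennreal s < maximal (\<lambda>y. ennreal (f y)) x}. ?w x \<partial>lborel) \<partial>lborel)"
      by (rule weighted_modular_layer_cake[OF \<phi>]) simp
    also have "\<dots> \<le> (\<integral>\<^sup>+ s. ?\<phi> s * (\<integral>\<^sup>+ y. ?F s y \<partial>lborel) \<partial>lborel)"
    proof (rule nn_integral_mono)
      fix s :: real
      show "?\<phi> s * (\<integral>\<^sup>+ x\<in>{x. ennreal s < maximal (\<lambda>y. ennreal (f y)) x}. ?w x \<partial>lborel)
          \<le> ?\<phi> s * (\<integral>\<^sup>+ y. ?F s y \<partial>lborel)"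
        by (cases "0 < s") (auto intro!: mult_left_mono weak f)
    qed
    also have "\<dots> = (\<integral>\<^sup>+ s. (\<integral>\<^sup>+ y. ?\<phi> s * ?F s y \<partial>lborel) \<partial>lborel)"
      by (intro nn_integral_cong nn_integral_cmult[symmetric]) measurable
    also have "\<dots> = (\<integral>\<^sup>+ y. (\<integral>\<^sup>+ s. ?\<phi> s * ?F s y \<partial>lborel) \<partial>lborel)"
      by (rule lborel_pair.Fubini') measurable
    also have "\<dots> \<le> (\<integral>\<^sup>+ y. ennreal E * (young_function \<phi> (ennreal (2 / \<kappa> * f y)) * ?w y) \<partial>lborel)"
    proof (rule nn_integral_mono)
      fix y
      show "(\<integral>\<^sup>+ s. ?\<phi> s * ?F s y \<partial>lborel)
          \<le> ennreal E * (young_function \<phi> (ennreal (2 / \<kappa> * f y)) * ?w y)"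
      proof (cases "0 < f y")
        case False
        then have "f y = 0" using f[of y] by simp
        then have zero: "?F s y = 0" for s by auto
        show ?thesis unfolding zero by simp
      next
        case True
        let ?r = "f y / \<kappa>" and ?c = "C * (f y powr p * \<bar>y\<bar> powr \<gamma>)"
        have r: "0 < ?r" using True C by simp
        have c: "0 \<le> ?c" using C by simp
        have "(\<integral>\<^sup>+ s. ?\<phi> s * ?F s y \<partial>lborel) =
          (\<integral>\<^sup>+ s. ennreal ?c * (ennreal (\<phi> s * indicator {0<..} s * s powr (-p))
              * indicator {0<..<?r} s) \<partial>lborel)"
        proof (rule nn_integral_cong)
          fix s :: real
          show "?\<phi> s * ?F s y = ennreal ?c * (ennreal (\<phi> s * indicator {0<..} s * s powr (-p))
              * indicator {0<..<?r} s)"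
          proof (cases "0 < s \<and> s < ?r")
            case True
            then have s: "0 < s" "\<kappa> * s < f y" "s < ?r" using C by (auto simp: field_simps)
            have "ennreal (\<phi> s) * ennreal (C * s powr (-p) * (f y powr p * \<bar>y\<bar> powr \<gamma>)) =
              ennreal (\<phi> s * (C * s powr (-p) * (f y powr p * \<bar>y\<bar> powr \<gamma>)))"
              using young_densityD(1)[OF \<phi> s(1)] by (rule ennreal_mult'[symmetric])
            also have "\<phi> s * (C * s powr (-p) * (f y powr p * \<bar>y\<bar> powr \<gamma>))
                = ?c * (\<phi> s * s powr (-p))" by simp
            also have "ennreal \<dots> = ennreal ?c * ennreal (\<phi> s * s powr (-p))" using c
              by (rule ennreal_mult')
            finally show ?thesis using s by simp
          next
            case False
            then show ?thesis using C by (auto simp: indicator_def field_simps)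
          qed
        qed
        also have "\<dots> = ennreal ?c * (\<integral>\<^sup>+ s. ennreal (\<phi> s * indicator {0<..} s * s powr (-p))
            * indicator {0<..<?r} s \<partial>lborel)"
          by (rule nn_integral_cmult) measurable
        also have "(\<integral>\<^sup>+ s. ennreal (\<phi> s * indicator {0<..} s * s powr (-p))
            * indicator {0<..<?r} s \<partial>lborel) =
          (\<integral>\<^sup>+ s\<in>{0<..<?r}. ennreal (\<phi> s * s powr (-p)) \<partial>lborel)"
          by (intro nn_integral_cong) (auto simp: indicator_def)
        also have "\<dots> \<le> ennreal (D * (?r powr (1 - p) * \<phi> ?r))"
          unfolding D_def by (rule density_kernel_le[OF \<phi> k p(3) growth r])
        finally have "(\<integral>\<^sup>+ s. ?\<phi> s * ?F s y \<partial>lborel)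
            \<le> ennreal ?c * ennreal (D * (?r powr (1 - p) * \<phi> ?r))"
          by (simp add: mult_left_mono)
        also have "\<dots> = ennreal (?c * (D * (?r powr (1 - p) * \<phi> ?r)))" using c
          by (rule ennreal_mult'[symmetric])
        also have "?c * (D * (?r powr (1 - p) * \<phi> ?r))
            = C * D * \<kappa> powr p * (?r * \<phi> ?r * \<bar>y\<bar> powr \<gamma>)"
        proof -
          have "f y powr p * ?r powr (1 - p) = \<kappa> powr p * (?r powr p * ?r powr (1 - p))"
            using True C by (simp add: powr_divide)
          also have "?r powr p * ?r powr (1 - p) = ?r" using r True C
            by (simp add: powr_add[symmetric])
          finally show ?thesis by (simp only: mult_ac)
        qed
        also have "\<dots> \<le> E * (?r * \<phi> ?r * \<bar>y\<bar> powr \<gamma>)"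
          using r young_densityD(1)[OF \<phi> r]
          by (intro mult_right_mono mult_nonneg_nonneg less_imp_le[OF r]) (auto simp: E_def)
        finally have "(\<integral>\<^sup>+ s. ?\<phi> s * ?F s y \<partial>lborel) \<le> ennreal (E * (?r * \<phi> ?r * \<bar>y\<bar> powr \<gamma>))"
          by (simp add: ennreal_leI)
        also have "\<dots> = ennreal E * (ennreal (?r * \<phi> ?r) * ?w y)"
          by (simp add: E_def ennreal_mult' ennreal_mult'' del: times_divide_eq_left)
        also have "\<dots> \<le> ennreal E * (young_function \<phi> (ennreal (2 * ?r)) * ?w y)"
          by (intro mult_left_mono mult_right_mono young_function_ge[OF mono r]) auto
        finally show ?thesis by simp
      qed
    qed
    also have "\<dots> \<le> (\<integral>\<^sup>+ y. young_function \<phi> (ennreal (E * (2 / \<kappa>)) * ennreal (f y)) * ?w y \<partial>lborel)"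
    proof (rule nn_integral_mono)
      fix y
      have "ennreal E * young_function \<phi> (ennreal (2 / \<kappa> * f y))
          \<le> young_function \<phi> (ennreal E * ennreal (2 / \<kappa> * f y))"
        by (rule young_function_le_scale[OF mono]) (simp add: E_def)
      also have "ennreal E * ennreal (2 / \<kappa> * f y) = ennreal (E * (2 / \<kappa>)) * ennreal (f y)"
        using f[of y] C by (simp add: E_def ennreal_mult'[symmetric] ennreal_mult''[symmetric])
      finally show "ennreal E * (young_function \<phi> (ennreal (2 / \<kappa> * f y)) * ?w y)
          \<le> young_function \<phi> (ennreal (E * (2 / \<kappa>)) * ennreal (f y)) * ?w y"
        unfolding mult.assoc[symmetric] by (rule mult_right_mono) simp
    qed
    also have "\<dots> = weighted_modular \<phi> \<gamma> (\<lambda>y. ennreal (E * (2 / \<kappa>)) * ennreal (f y))"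
      unfolding weighted_modular_def ..
    finally show "weighted_modular \<phi> \<gamma> (maximal (\<lambda>y. ennreal (f y)))
        \<le> weighted_modular \<phi> \<gamma> (\<lambda>y. ennreal (E * (2 / \<kappa>)) * ennreal (f y))" .
  qed
qed

lemma young_function_top:
  assumes \<phi>: "young_density \<phi>" shows "young_function \<phi> top = top"
proof (rule ccontr)
  assume "young_function \<phi> top \<noteq> top"
  then obtain B where B: "0 \<le> B" "young_function \<phi> top = ennreal B"
    by (cases "young_function \<phi> top") auto
  obtain r where r: "0 < r" "B < \<phi> r" using young_density_large[OF \<phi>] .
  let ?t = "max r 1"
  have t: "0 < ?t" by simp
  have "B < \<phi> ?t" using r young_densityD(2)[OF \<phi>, of r ?t] by simp
  also have "\<phi> ?t \<le> ?t * \<phi> ?t" using young_densityD(1)[OF \<phi> t] by (simp add: mult_le_cancel_right1)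
  finally have "ennreal B < ennreal (?t * \<phi> ?t)" using B(1) by (simp add: ennreal_lessI)
  also have "\<dots> \<le> young_function \<phi> (ennreal (2 * ?t))"
    by (rule young_function_ge[OF young_densityD(3)[OF \<phi>] t])
  also have "\<dots> \<le> young_function \<phi> top" by (rule young_function_mono) simp
  finally show False using B by simp
qed

lemma maximal_cong_AE:
  assumes "AE y in lborel. u y = v y"
  shows "maximal u = maximal v"
proof
  have "(\<integral>\<^sup>+ y\<in>{a<..<b}. u y \<partial>lborel) = (\<integral>\<^sup>+ y\<in>{a<..<b}. v y \<partial>lborel)" for a b
    by (rule nn_integral_cong_AE) (use assms in auto)
  then show "maximal u x = maximal v x" for x unfolding maximal_def by simp
qed

text \<open>
Since \<open>\<Phi>(\<infinity>) = \<infinity>\<close>, a function with finite modular is finite almost everywhere and may be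
replaced by a real-valued one.
\<close>

lemma modular_bound_of_growth_exponent:
  assumes \<phi>: "young_density \<phi>" and \<gamma>: "-1 < \<gamma>" and q: "max \<gamma> 0 < q" "growth_exponent \<phi> q"
  shows "maximal_modular_bound \<phi> \<gamma>"
proof -
  obtain K where K: "0 < K" and bound:
    "\<And>f. f \<in> borel_measurable borel \<Longrightarrow> (\<And>y. 0 \<le> f y) \<Longrightarrow>
      weighted_modular \<phi> \<gamma> (maximal (\<lambda>y. ennreal (f y)))
          \<le> weighted_modular \<phi> \<gamma> (\<lambda>y. ennreal K * ennreal (f y))"
    by (rule modular_bound_real[OF assms]) blast
  show ?thesis
    unfolding maximal_modular_bound_def
  proof (intro exI[of _ K] conjI ballI K)
    fix u :: "real \<Rightarrow> ennreal" assume [measurable]: "u \<in> borel_measurable borel"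
    show "weighted_modular \<phi> \<gamma> (maximal u) \<le> weighted_modular \<phi> \<gamma> (\<lambda>y. ennreal K * u y)"
    proof (cases "weighted_modular \<phi> \<gamma> (\<lambda>y. ennreal K * u y) = \<infinity>")
      case False
      then have "AE x in lborel. young_function \<phi> (ennreal K * u x) * ennreal (\<bar>x\<bar> powr \<gamma>) \<noteq> \<infinity>"
        unfolding weighted_modular_def by (intro nn_integral_PInf_AE) simp_all
      moreover have "AE x in lborel. x \<noteq> (0::real)" by (rule AE_lborel_singleton)
      ultimately have fin: "AE x in lborel. u x = ennreal (enn2real (u x))"
      proof eventually_elim
        case (elim x)
        have "u x \<noteq> top"
        proof
          assume "u x = top"
          then have "young_function \<phi> (ennreal K * u x) * ennreal (\<bar>x\<bar> powr \<gamma>) = top"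
            using K elim(2) by (simp add: young_function_top[OF \<phi>] ennreal_mult_top ennreal_top_mult)
          with elim(1) show False by simp
        qed
        then show ?case by (simp add: less_top)
      qed
      have "weighted_modular \<phi> \<gamma> (maximal u)
          = weighted_modular \<phi> \<gamma> (maximal (\<lambda>y. ennreal (enn2real (u y))))"
        using maximal_cong_AE[OF fin] by simp
      also have "\<dots> \<le> weighted_modular \<phi> \<gamma> (\<lambda>y. ennreal K * ennreal (enn2real (u y)))"
        by (rule bound) simp_all
      also have "\<dots> = weighted_modular \<phi> \<gamma> (\<lambda>y. ennreal K * u y)"
        unfolding weighted_modular_def by (rule nn_integral_cong_AE) (use fin in auto)
      finally show ?thesis .
    qed simp
  qed
qed

section \<open>The equivalence\<close>

theorem theorem3:
  fixes \<gamma> :: real and \<phi> :: "real \<Rightarrow> real" and \<Phi> \<Psi> :: "ennreal \<Rightarrow> ennreal"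
    and G I M BK :: bool
  assumes "\<gamma> > -1"
    and "young_density \<phi>"
    and "\<Phi> = young_function \<phi>"
    and "\<Psi> = complementary_function \<phi>"
  defines "G \<equiv> \<exists>L>0. \<forall>f \<in> borel_measurable lebesgue.
      luxemburg_norm \<Phi> \<gamma> (hardy_littlewood f) \<le> ennreal L * luxemburg_norm \<Phi> \<gamma> f"
    and "I \<equiv> hardy_littlewood \<in> orlicz_class \<Phi> \<gamma> \<rightarrow> orlicz_class \<Phi> \<gamma>"
    and "M \<equiv> \<exists>K>0. \<forall>f \<in> borel_measurable lebesgue.
      orlicz_modular \<Phi> \<gamma> (hardy_littlewood f) \<le> orlicz_modular \<Phi> \<gamma> (\<lambda>y. ereal K * \<bar>f y\<bar>)"
    and "BK \<equiv> \<exists>C\<ge>1.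
      (\<forall>t>0. \<Psi> (ennreal (2 * t)) \<le> ennreal C * \<Psi> (ennreal t)) \<and>
      ((-1 < \<gamma> \<and> \<gamma> < 0) \<or>
       (\<gamma> \<ge> 0 \<and>
        (\<forall>t>0. ennreal (1 / t) *
            (\<integral>\<^sup>+ s\<in>{0<..<t}. ennreal (gen_inverse \<phi> (s powr (-\<gamma>))) \<partial>lborel)
          \<le> ennreal (C * gen_inverse \<phi> (C * t powr (-\<gamma>))))))"
  shows "(G \<longleftrightarrow> I) \<and> (I \<longleftrightarrow> M) \<and> (M \<longleftrightarrow> BK)"
proof -
  note \<gamma> = assms(1) and \<phi> = assms(2)
  note mono = young_densityD(3)[OF \<phi>]
  have G: "G \<longleftrightarrow> maximal_norm_bound \<phi> \<gamma>" unfolding G_def assms(3) by (rule norm_bound_iff)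
  have I: "I \<longleftrightarrow> maximal_preserves_class \<phi> \<gamma>" unfolding I_def assms(3) by (rule preserves_class_iff)
  have M: "M \<longleftrightarrow> maximal_modular_bound \<phi> \<gamma>" unfolding M_def assms(3) by (rule modular_bound_iff)
  have "M \<Longrightarrow> I" unfolding M I by (rule preserves_class_of_modular_bound)
  moreover have "I \<Longrightarrow> G" unfolding I G by (rule norm_bound_of_preserves_class[OF mono])
  moreover have "G \<Longrightarrow> M" unfolding G M by (rule modular_bound_of_norm_bound[OF \<gamma>])
  moreover have BK if hM: M
  proof -
    obtain b where b: "1 < b" "\<And>t. 0 < t \<Longrightarrow> 2 * \<phi> t \<le> \<phi> (b * t)"
      using doubling_of_modular_bound[OF \<phi>] hM M by blast
    obtain C where C: "1 \<le> C" and avg: "\<And>t. 0 < t \<Longrightarrow> ennreal (1 / t) *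
       (\<integral>\<^sup>+ s\<in>{0<..<t}. ennreal (gen_inverse \<phi> (s powr (-\<gamma>))) \<partial>lborel)
       \<le> ennreal (C * gen_inverse \<phi> (C * t powr (-\<gamma>)))"
      using average_condition_of_modular_bound[OF \<phi> \<gamma>] hM M by blast
    define C' where "C' = max C (2 * b)"
    have "\<Psi> (ennreal (2 * t)) \<le> ennreal C' * \<Psi> (ennreal t)" if "0 < t" for t
    proof -
      have "\<Psi> (ennreal (2 * t)) \<le> ennreal (2 * b) * \<Psi> (ennreal t)"
        unfolding assms(4) by (rule complementary_doubling_of_doubling[OF \<phi> b])
      also have "\<dots> \<le> ennreal C' * \<Psi> (ennreal t)"
        by (intro mult_right_mono ennreal_leI) (auto simp: C'_def)
      finally show ?thesis .
    qed
    moreover have "ennreal (1 / t) *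
       (\<integral>\<^sup>+ s\<in>{0<..<t}. ennreal (gen_inverse \<phi> (s powr (-\<gamma>))) \<partial>lborel)
       \<le> ennreal (C' * gen_inverse \<phi> (C' * t powr (-\<gamma>)))" if t: "0 < t" for t
    proof -
      have "C * gen_inverse \<phi> (C * t powr (-\<gamma>)) \<le> C' * gen_inverse \<phi> (C' * t powr (-\<gamma>))"
        using t C gen_inverse_pos[OF \<phi>, of "C * t powr (-\<gamma>)"]
        by (intro mult_mono gen_inverse_mono[OF \<phi>] mult_right_mono) (auto simp: C'_def)
      with avg[OF t] show ?thesis by (meson ennreal_leI order_trans)
    qed
    moreover have "1 \<le> C'" using C by (simp add: C'_def)
    ultimately show BK unfolding BK_def using \<gamma> by (intro exI[of _ C']) auto
  qed
  moreover have M if hBK: BK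
  proof -
    obtain C where C: "1 \<le> C"
      and doubling: "\<forall>t>0. \<Psi> (ennreal (2 * t)) \<le> ennreal C * \<Psi> (ennreal t)"
      and cases: "(-1 < \<gamma> \<and> \<gamma> < 0) \<or> (\<gamma> \<ge> 0 \<and> (\<forall>t>0. ennreal (1 / t) *
         (\<integral>\<^sup>+ s\<in>{0<..<t}. ennreal (gen_inverse \<phi> (s powr (-\<gamma>))) \<partial>lborel)
         \<le> ennreal (C * gen_inverse \<phi> (C * t powr (-\<gamma>)))))"
      using hBK unfolding BK_def by blast
    have "\<exists>q>max \<gamma> 0. growth_exponent \<phi> q"
    proof (cases "0 < \<gamma>")
      case True
      then show ?thesis using growth_exponent_of_average_condition[OF \<phi> True C] cases by auto
    next
      case False
      have "1 < C\<^sup>2 + 1" using C by simp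
      moreover have "\<And>t. 0 < t \<Longrightarrow> 2 * \<phi> t \<le> \<phi> ((C\<^sup>2 + 1) * t)"
        by (rule doubling_of_complementary_doubling[OF \<phi> C]) (use doubling assms(4) in auto)
      ultimately have "\<exists>q>0. growth_exponent \<phi> q" by (rule growth_exponent_pos_of_doubling[OF \<phi>])
      then show ?thesis using False by (auto simp: max_def)
    qed
    then show M unfolding M using modular_bound_of_growth_exponent[OF \<phi> \<gamma>] by blast
  qed
  ultimately show ?thesis by blast
qed

end
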